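(* Let $s$ be a positive integer, let $H_1,\dots,H_s$ be fixed finite simple graphs with $H_1$ a single edge, and let $e\in[0,1]$. There exist positive constants $c$ and $C$, which may depend only on $H_1,\dots,H_s$ and $e$, such that the following holds. Let $N\ge2$ be an integer, $n=\binom N2$, $t>0$, $\kappa>8$, and let $\zeta_1,\dots,\zeta_s$ be real parameters. Let $f(x)=\zeta_1T_1(x)+\cdots+\zeta_sT_s(x)$ and $h(x)=T_1(x)-N^2e$ for $x\in[0,1]^n$, let $B=1+|\zeta_1|+\cdots+|\zeta_s|$, and let $t'=2Nt/(N-1)$. Then $$\sup_{x\in[0,1]^n:\,|h(x)|\le (t'-cn^{-1/(2\kappa)})n}\frac{f(x)-I(x)}{N^2}-CBN^{-1/2}\le \psi^{e,\zeta}_{N,t}$$ and $$\psi^{e,\zeta}_{N,t}\le \sup_{x\in[0,1]^n:\,|h(x)|\le (t'+cn^{-1/(2\kappa)})n}\frac{f(x)-I(x)}{N^2}+CB^{8/5}N^{(8-\kappa)/(5\kappa)}(\log N)^{1/5}\left(1+\frac{\log B}{\log N}\right)+CB^2N^{(2-\kappa)/(2\kappa)}.$$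
   Context: "Simple graph" means undirected, without loops or multiple edges. $\mathcal{G}_N$ is the set of all simple graphs on the vertex set $[N]=\{1,\dots,N\}$. For a finite simple graph $H$ and $G_N\in\mathcal{G}_N$, the homomorphism density is $t(H,G_N)=|\mathrm{hom}(H,G_N)|/N^{|V(H)|}$, where $\mathrm{hom}(H,G_N)$ is the set of edge-preserving vertex maps $V(H)\to V(G_N)$. The edge density of $G_N$ is $e(G_N)=t(H_1,G_N)$, where $H_1$ is a single edge (so $e(G_N)=2|E(G_N)|/N^2$). The conditional normalization constant is $$\psi^{e,\zeta}_{N,t}=\frac1{N^2}\log\sum_{G_N\in\mathcal{G}_N:\,|e(G_N)-e|\le t}\exp\bigl(N^2(\zeta_1t(H_1,G_N)+\cdots+\zeta_st(H_s,G_N))\bigr)$$ (equal to $-\infty$ if the sum is empty). Elements of $[0,1]^n$, $n=\binom N2$, are indexed as $x=(x_{ij})_{1\le i<j\le N}$, with the convention $x_{ji}=x_{ij}$ for $i<j$ and $x_{ii}=0$. For $H_r$ with vertex set $\{1,\dots,k_r\}$ and edge set $E_r$, $$T_r(x)=\frac1{N^{k_r-2}}\sum_{q\in[N]^{k_r}}\ \prod_{\{l,l'\}\in E_r}x_{q_lq_{l'}}.$$ $I(x)=\sum_{1\le i<j\le N}\bigl(x_{ij}\log x_{ij}+(1-x_{ij})\log(1-x_{ij})\bigr)$, with $0\log0=0$. A supremum over the empty set is $-\infty$. *)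

theory Defs
  imports Complex_Main "HOL-Library.FuncSet" "HOL-Library.Extended_Real"
begin

text \<open>A graph is a pair of a vertex set and a set of edges, each edge being an unordered pair,
  i.e. a two-element set of vertices.\<close>

type_synonym 'a sgraph = "'a set \<times> 'a set set"

abbreviation vset :: "'a sgraph \<Rightarrow> 'a set" where
  "vset H \<equiv> fst H"

abbreviation eset :: "'a sgraph \<Rightarrow> 'a set set" where
  "eset H \<equiv> snd H"

definition simple_graph :: "'a sgraph \<Rightarrow> bool" where
  "simple_graph H \<longleftrightarrow> finite (vset H) \<and> (\<forall>d\<in>eset H. d \<subseteq> vset H \<and> card d = 2)"

definition graphs_on :: "nat \<Rightarrow> nat sgraph set" where
  "graphs_on N = {G. simple_graph G \<and> vset G = {1..N}}"

definition single_edge :: "nat sgraph" where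
  "single_edge = ({1, 2}, {{1, 2}})"

definition hom_set :: "'a sgraph \<Rightarrow> 'b sgraph \<Rightarrow> ('a \<Rightarrow> 'b) set" where
  "hom_set H G = {\<phi> \<in> vset H \<rightarrow>\<^sub>E vset G. \<forall>u v. {u, v} \<in> eset H \<longrightarrow> {\<phi> u, \<phi> v} \<in> eset G}"

definition hom_density :: "'a sgraph \<Rightarrow> 'b sgraph \<Rightarrow> real" where
  "hom_density H G = real (card (hom_set H G)) / real (card (vset G)) ^ card (vset H)"

definition edge_density :: "nat sgraph \<Rightarrow> real" where
  "edge_density G = hom_density single_edge G"

definition cond_graphs :: "real \<Rightarrow> nat \<Rightarrow> real \<Rightarrow> nat sgraph set" where
  "cond_graphs e N t = {G \<in> graphs_on N. \<bar>edge_density G - e\<bar> \<le> t}"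

text \<open>The graphs \<open>H\<^sub>1, \<dots>, H\<^sub>s\<close> and the parameters are functions on \<open>nat\<close>, of which only
  the values at \<open>1, \<dots>, s\<close> are used.\<close>

definition cond_psi :: "nat \<Rightarrow> (nat \<Rightarrow> nat sgraph) \<Rightarrow> real \<Rightarrow> (nat \<Rightarrow> real) \<Rightarrow> nat \<Rightarrow> real \<Rightarrow> ereal" where
  "cond_psi s H e \<zeta> N t =
     (if cond_graphs e N t = {} then - \<infinity>
      else ereal (1 / real N ^ 2 *
        ln (\<Sum>G\<in>cond_graphs e N t.
              exp (real N ^ 2 * (\<Sum>r = 1..s. \<zeta> r * hom_density (H r) G)))))"

definition index_pairs :: "nat \<Rightarrow> (nat \<times> nat) set" where
  "index_pairs N = {(i, j). 1 \<le> i \<and> i < j \<and> j \<le> N}"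

definition cube :: "nat \<Rightarrow> (nat \<times> nat \<Rightarrow> real) set" where
  "cube N = index_pairs N \<rightarrow>\<^sub>E {0..1}"

definition coord :: "(nat \<times> nat \<Rightarrow> real) \<Rightarrow> nat \<Rightarrow> nat \<Rightarrow> real" where
  "coord x i j = (if i < j then x (i, j) else if j < i then x (j, i) else 0)"

text \<open>For \<open>H\<close> with vertex set \<open>{1..k}\<close>. The product has one factor per edge \<open>{l, l'}\<close>: each edge is
  listed once, with its smaller endpoint first. The exponent \<open>k - 2\<close> may be negative.\<close>

definition T_fun :: "nat \<Rightarrow> nat sgraph \<Rightarrow> (nat \<times> nat \<Rightarrow> real) \<Rightarrow> real" where
  "T_fun N H x =
     1 / real N powi (int (card (vset H)) - 2) *
     (\<Sum>q \<in> vset H \<rightarrow>\<^sub>E {1..N}.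
        \<Prod>(l, l') \<in> {(l, l'). l < l' \<and> {l, l'} \<in> eset H}. coord x (q l) (q l'))"

text \<open>The convention \<open>0 log 0 = 0\<close> holds because \<open>0 * y = 0\<close>.\<close>

definition I_fun :: "nat \<Rightarrow> (nat \<times> nat \<Rightarrow> real) \<Rightarrow> real" where
  "I_fun N x = (\<Sum>p \<in> index_pairs N. x p * ln (x p) + (1 - x p) * ln (1 - x p))"

end

theory Submission
  imports Defs
begin

text \<open>
  A graph on \<open>{1..N}\<close> is encoded by its edge set \<open>S \<subseteq> index_pairs N\<close>. With \<open>f\<close> the given combination
  of homomorphism counts, \<open>N\<^sup>2\<close> times the normalization constant becomes \<open>ln Z\<close>, where \<open>Z\<close> is the sum
  of \<open>exp (f S)\<close> over all \<open>S\<close> whose edge count lies in the window (\<open>cond_psi_eq\<close>). The theorem compares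
  \<open>ln Z\<close> with the mean-field functional \<open>f - I\<close>, that is, with what product measures achieve in the Gibbs
  variational principle.

  Upper bound. Let \<open>S\<close> be random with the Gibbs weights \<open>exp (f S) / Z\<close> and reveal the stars, that is the
  full neighbourhoods, of \<open>m\<close> vertices. Let \<open>x\<close> be the vector of conditional edge probabilities.
  Comparing the Gibbs weights with a mixture of the product measures of parameters \<open>x\<close> costs at most the
  logarithm \<open>m N ln 2\<close> of the number of possible outcomes, and gives
  \<open>ln Z \<le> m N ln 2 + E (f S - I x)\<close> (\<open>mean_field_bound\<close>). It remains to replace \<open>f S\<close> by \<open>f x\<close>, so the
  indicators of the edges in the image of a pattern graph have to be nearly uncorrelated given what has
  been revealed. The mean square of the conditional expectation of a bounded quantity can only increase
  when more is revealed and stays bounded, so for some \<open>m < w\<close> revealing one more uniformly random star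
  raises it, on average, by \<open>O (1 / w)\<close> (\<open>energy_increment\<close>, \<open>exists_stabilizing_stars\<close>). If
  learning the star of a vertex \<open>u\<close> hardly changes the prediction for the edges not at \<open>u\<close>, the latter are
  nearly uncorrelated with the edges at \<open>u\<close> (\<open>cond_covariance_le\<close>). Since the images of the pattern
  vertices are themselves uniformly random, every pattern can be taken apart vertex by vertex
  (\<open>edge_prod_mean_factor\<close>), at a total cost \<open>O (B N\<^sup>2 / sqrt w)\<close>. With \<open>w\<close> about \<open>sqrt N\<close> all errors are
  \<open>O (B N\<^sup>2 N powr (- 1 / 4))\<close>, which is dominated by the first error term of the statement, its exponent
  \<open>(8 - \<kappa>) / (5 * \<kappa>)\<close> being larger than \<open>- 1 / 5\<close>. The edge count is linear, so \<open>x\<close>, a vector of conditional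
  means, satisfies every window that the graphs satisfy; some outcome of the revealed stars is at least as
  good as the average and provides the point of the supremum.

  Lower bound. For \<open>x\<close> in the smaller window, draw \<open>S\<close> with independent edges of probabilities \<open>x\<close>. Two
  copies of a pattern placed injectively and disjointly are independent, and only a fraction \<open>O (1 / N)\<close>
  of all pairs of placements is not of this kind; hence the homomorphism counts, which are of order \<open>N\<^sup>2\<close>,
  deviate from their values at \<open>x\<close> by \<open>O (N powr (3 / 2))\<close> only (\<open>expect_T_fun_square\<close>). The logarithm
  of the probability of \<open>S\<close> concentrates around \<open>I x\<close> to within \<open>O (N)\<close> (\<open>expect_ln_bern_square\<close>).
  So with probability at least \<open>1 / 4\<close> the edge count of \<open>S\<close> is in the larger window while \<open>f S\<close> is close to
  \<open>f x\<close> and the probability of \<open>S\<close> to \<open>exp (I x)\<close>; summing \<open>exp (f S)\<close> over these \<open>S\<close> yields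
  \<open>exp (f x - I x)\<close> up to a factor \<open>exp (O (B N powr (3 / 2)))\<close> (\<open>ln_partition_ge\<close>).
\<close>

section \<open>Conditional expectation on a finite probability space\<close>

text \<open>
  The weights are strictly positive, so that every fibre of a map on the space has positive mass and
  conditioning on the value of the map is always meaningful.
\<close>
locale finite_prob =
  fixes \<Omega> :: "'a set" and \<mu> :: "'a \<Rightarrow> real"
  assumes finite_space: "finite \<Omega>"
    and weight_pos: "\<omega> \<in> \<Omega> \<Longrightarrow> 0 < \<mu> \<omega>"
    and total_weight: "sum \<mu> \<Omega> = 1"
begin

definition expect :: "('a \<Rightarrow> real) \<Rightarrow> real" where
  "expect F = (\<Sum>\<omega>\<in>\<Omega>. \<mu> \<omega> * F \<omega>)"

definition fibre_indicator :: "('a \<Rightarrow> 'b) \<Rightarrow> 'a \<Rightarrow> 'a \<Rightarrow> real" where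
  "fibre_indicator \<sigma> \<omega> \<omega>' = of_bool (\<sigma> \<omega>' = \<sigma> \<omega>)"

definition cond :: "('a \<Rightarrow> 'b) \<Rightarrow> ('a \<Rightarrow> real) \<Rightarrow> 'a \<Rightarrow> real" where
  "cond \<sigma> F \<omega> = expect (\<lambda>\<omega>'. fibre_indicator \<sigma> \<omega> \<omega>' * F \<omega>') / expect (fibre_indicator \<sigma> \<omega>)"

text \<open>
  Measurability of \<open>G\<close> with respect to the partition into fibres of \<open>\<sigma>\<close>. For another map \<open>\<tau>\<close>,
  \<open>determined_by \<tau> \<sigma>\<close> says that \<open>\<tau>\<close> reveals at least as much as \<open>\<sigma>\<close>.
\<close>
definition determined_by :: "('a \<Rightarrow> 'b) \<Rightarrow> ('a \<Rightarrow> 'c) \<Rightarrow> bool" where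
  "determined_by \<sigma> G \<longleftrightarrow> (\<forall>\<omega>\<in>\<Omega>. \<forall>\<omega>'\<in>\<Omega>. \<sigma> \<omega> = \<sigma> \<omega>' \<longrightarrow> G \<omega> = G \<omega>')"

lemma determined_byD:
  "determined_by \<sigma> G \<Longrightarrow> \<omega> \<in> \<Omega> \<Longrightarrow> \<omega>' \<in> \<Omega> \<Longrightarrow> \<sigma> \<omega> = \<sigma> \<omega>' \<Longrightarrow> G \<omega> = G \<omega>'"
  unfolding determined_by_def by blast

lemma expect_cong: "(\<And>\<omega>. \<omega> \<in> \<Omega> \<Longrightarrow> F \<omega> = G \<omega>) \<Longrightarrow> expect F = expect G"
  by (simp add: expect_def)

lemma expect_mono: "(\<And>\<omega>. \<omega> \<in> \<Omega> \<Longrightarrow> F \<omega> \<le> G \<omega>) \<Longrightarrow> expect F \<le> expect G"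
  unfolding expect_def by (intro sum_mono mult_left_mono) (auto simp: less_imp_le weight_pos)

lemma expect_add: "expect (\<lambda>\<omega>. F \<omega> + G \<omega>) = expect F + expect G"
  by (simp add: expect_def distrib_left sum.distrib)

lemma expect_diff: "expect (\<lambda>\<omega>. F \<omega> - G \<omega>) = expect F - expect G"
  by (simp add: expect_def right_diff_distrib sum_subtractf)

lemma expect_cmult: "expect (\<lambda>\<omega>. c * F \<omega>) = c * expect F"
  by (simp add: expect_def sum_distrib_left ac_simps)

lemma expect_const: "expect (\<lambda>_. c) = c"
  by (simp add: expect_def sum_distrib_right[symmetric] total_weight)

lemma expect_sum: "expect (\<lambda>\<omega>. \<Sum>i\<in>A. F i \<omega>) = (\<Sum>i\<in>A. expect (F i))"
  unfolding expect_def sum_distrib_left by (rule sum.swap)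

lemma expect_abs_le: "\<bar>expect F\<bar> \<le> expect (\<lambda>\<omega>. \<bar>F \<omega>\<bar>)"
proof -
  have "\<bar>expect F\<bar> \<le> (\<Sum>\<omega>\<in>\<Omega>. \<bar>\<mu> \<omega> * F \<omega>\<bar>)"
    unfolding expect_def by (rule sum_abs)
  also have "\<dots> = expect (\<lambda>\<omega>. \<bar>F \<omega>\<bar>)"
    unfolding expect_def by (intro sum.cong) (auto simp: abs_mult less_imp_le weight_pos)
  finally show ?thesis .
qed

lemma expect_le_some: "\<exists>\<omega>\<in>\<Omega>. expect F \<le> F \<omega>"
proof (rule ccontr)
  assume "\<not> ?thesis"
  then have less: "F \<omega> < expect F" if "\<omega> \<in> \<Omega>" for \<omega>
    using that by auto
  have "\<Omega> \<noteq> {}" using total_weight by auto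
  then have "expect F < (\<Sum>\<omega>\<in>\<Omega>. \<mu> \<omega> * expect F)"
    unfolding expect_def[of F] by (intro sum_strict_mono) (use finite_space less weight_pos in \<open>auto simp: expect_def\<close>)
  also have "\<dots> = expect F"
    by (simp add: sum_distrib_right[symmetric] total_weight)
  finally show False by simp
qed

lemma fibre_mass_pos: "\<omega> \<in> \<Omega> \<Longrightarrow> 0 < expect (fibre_indicator \<sigma> \<omega>)"
  unfolding expect_def fibre_indicator_def
  by (rule sum_pos2[of _ \<omega>]) (auto simp: finite_space weight_pos less_imp_le)

lemma cond_diff: "cond \<sigma> (\<lambda>\<omega>. F \<omega> - G \<omega>) \<omega> = cond \<sigma> F \<omega> - cond \<sigma> G \<omega>"
  by (simp add: cond_def right_diff_distrib expect_diff diff_divide_distrib)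

lemma cond_cmult: "cond \<sigma> (\<lambda>\<omega>. c * F \<omega>) \<omega> = c * cond \<sigma> F \<omega>"
  by (simp add: cond_def mult.left_commute[of _ c] expect_cmult)

lemma cond_sum: "cond \<sigma> (\<lambda>\<omega>. \<Sum>i\<in>A. F i \<omega>) \<omega> = (\<Sum>i\<in>A. cond \<sigma> (F i) \<omega>)"
  by (simp add: cond_def sum_distrib_left expect_sum sum_divide_distrib)

lemma cond_mono:
  assumes "\<And>\<omega>. \<omega> \<in> \<Omega> \<Longrightarrow> F \<omega> \<le> G \<omega>" "\<omega> \<in> \<Omega>"
  shows "cond \<sigma> F \<omega> \<le> cond \<sigma> G \<omega>"
  unfolding cond_def
  by (intro divide_right_mono expect_mono mult_left_mono)
     (use assms fibre_mass_pos[of \<omega> \<sigma>] in \<open>auto simp: fibre_indicator_def\<close>)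

lemma cond_const: "\<omega> \<in> \<Omega> \<Longrightarrow> cond \<sigma> (\<lambda>_. c) \<omega> = c"
  using cond_cmult[of \<sigma> c "\<lambda>_. 1" \<omega>] fibre_mass_pos[of \<omega> \<sigma>] by (simp add: cond_def)

lemma cond_in_unit:
  assumes "\<And>\<omega>. \<omega> \<in> \<Omega> \<Longrightarrow> F \<omega> \<in> {0..1}" "\<omega> \<in> \<Omega>"
  shows "cond \<sigma> F \<omega> \<in> {0..1}"
  using cond_mono[of "\<lambda>_. 0" F \<omega> \<sigma>] cond_mono[of F "\<lambda>_. 1" \<omega> \<sigma>] assms
  by (auto simp: cond_const)

lemma cond_abs_le: "\<omega> \<in> \<Omega> \<Longrightarrow> \<bar>cond \<sigma> F \<omega>\<bar> \<le> cond \<sigma> (\<lambda>\<omega>. \<bar>F \<omega>\<bar>) \<omega>"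
  using cond_mono[of F "\<lambda>\<omega>. \<bar>F \<omega>\<bar>" \<omega> \<sigma>] cond_mono[of "\<lambda>\<omega>. - 1 * F \<omega>" "\<lambda>\<omega>. \<bar>F \<omega>\<bar>" \<omega> \<sigma>]
  by (simp only: cond_cmult) (simp add: abs_le_iff)

lemma cond_determined: "\<sigma> \<omega> = \<sigma> \<omega>' \<Longrightarrow> cond \<sigma> F \<omega> = cond \<sigma> F \<omega>'"
  by (simp add: cond_def fibre_indicator_def[abs_def])

lemma determined_by_cond: "determined_by \<tau> \<sigma> \<Longrightarrow> determined_by \<tau> (cond \<sigma> F)"
  by (auto simp: determined_by_def intro!: cond_determined)

text \<open>
  Defining property of conditional expectations. The left-hand side is a double sum over pairs of points
  in a common fibre; as \<open>G\<close> and the mass of the fibre agree at both points, they may be evaluated at the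
  second point instead of the first, and then the inner sum is the mass of the fibre.
\<close>
lemma expect_cond_mult:
  assumes "determined_by \<sigma> G"
  shows "expect (\<lambda>\<omega>. cond \<sigma> F \<omega> * G \<omega>) = expect (\<lambda>\<omega>. F \<omega> * G \<omega>)"
proof -
  define m where "m \<omega> = expect (fibre_indicator \<sigma> \<omega>)" for \<omega>
  \<comment> \<open>The summand of the double sum, with \<open>G\<close> and the mass of the fibre evaluated at the second point.\<close>
  define K where "K \<omega> \<omega>' = \<mu> \<omega>' * F \<omega>' * (G \<omega>' / m \<omega>') * (\<mu> \<omega> * fibre_indicator \<sigma> \<omega>' \<omega>)" for \<omega> \<omega>'
  have sym: "\<mu> \<omega>' * (fibre_indicator \<sigma> \<omega> \<omega>' * F \<omega>') * (\<mu> \<omega> * (G \<omega> / m \<omega>)) = K \<omega> \<omega>'"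
    if "\<omega> \<in> \<Omega>" "\<omega>' \<in> \<Omega>" for \<omega> \<omega>'
  proof (cases "\<sigma> \<omega> = \<sigma> \<omega>'")
    case True
    then have "fibre_indicator \<sigma> \<omega> = fibre_indicator \<sigma> \<omega>'" by (simp add: fibre_indicator_def fun_eq_iff)
    then have "m \<omega> = m \<omega>'" by (simp add: m_def)
    moreover have "G \<omega> = G \<omega>'" using determined_byD[OF assms that True] .
    ultimately show ?thesis using True by (simp add: K_def fibre_indicator_def)
  next
    case False
    then show ?thesis by (simp add: K_def fibre_indicator_def)
  qed
  have "\<mu> \<omega> * (cond \<sigma> F \<omega> * G \<omega>) = (\<Sum>\<omega>'\<in>\<Omega>. K \<omega> \<omega>')" if "\<omega> \<in> \<Omega>" for \<omega>
  proof -
    have "\<mu> \<omega> * (cond \<sigma> F \<omega> * G \<omega>)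
        = (\<Sum>\<omega>'\<in>\<Omega>. \<mu> \<omega>' * (fibre_indicator \<sigma> \<omega> \<omega>' * F \<omega>')) * (\<mu> \<omega> * (G \<omega> / m \<omega>))"
      by (simp add: cond_def expect_def m_def)
    also have "\<dots> = (\<Sum>\<omega>'\<in>\<Omega>. K \<omega> \<omega>')"
      unfolding sum_distrib_right by (rule sum.cong[OF refl]) (rule sym[OF that])
    finally show ?thesis .
  qed
  then have "expect (\<lambda>\<omega>. cond \<sigma> F \<omega> * G \<omega>) = (\<Sum>\<omega>\<in>\<Omega>. \<Sum>\<omega>'\<in>\<Omega>. K \<omega> \<omega>')"
    unfolding expect_def[of "\<lambda>\<omega>. cond \<sigma> F \<omega> * G \<omega>"] by (rule sum.cong[OF refl])
  also have "\<dots> = (\<Sum>\<omega>'\<in>\<Omega>. \<Sum>\<omega>\<in>\<Omega>. K \<omega> \<omega>')"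
    by (rule sum.swap)
  also have "\<dots> = (\<Sum>\<omega>'\<in>\<Omega>. \<mu> \<omega>' * (F \<omega>' * G \<omega>'))"
  proof (rule sum.cong[OF refl])
    fix \<omega>' assume "\<omega>' \<in> \<Omega>"
    then have "m \<omega>' \<noteq> 0" using fibre_mass_pos[of \<omega>' \<sigma>] by (simp add: m_def)
    have "(\<Sum>\<omega>\<in>\<Omega>. K \<omega> \<omega>') = \<mu> \<omega>' * F \<omega>' * (G \<omega>' / m \<omega>') * m \<omega>'"
      unfolding K_def sum_distrib_left[symmetric] by (simp only: m_def expect_def)
    also have "\<dots> = \<mu> \<omega>' * (F \<omega>' * G \<omega>')"
      using \<open>m \<omega>' \<noteq> 0\<close> by simp
    finally show "(\<Sum>\<omega>\<in>\<Omega>. K \<omega> \<omega>') = \<mu> \<omega>' * (F \<omega>' * G \<omega>')" .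
  qed
  finally show ?thesis
    by (simp only: expect_def)
qed

lemma expect_cond: "expect (cond \<sigma> F) = expect F"
  using expect_cond_mult[of \<sigma> "\<lambda>_. 1" F] by (simp add: determined_by_def)

lemma cond_cond_mult:
  assumes "determined_by \<tau> \<sigma>" "determined_by \<tau> G"
  shows "cond \<sigma> (\<lambda>\<omega>. cond \<tau> F \<omega> * G \<omega>) \<omega> = cond \<sigma> (\<lambda>\<omega>. F \<omega> * G \<omega>) \<omega>"
proof -
  have "determined_by \<tau> (\<lambda>\<omega>'. fibre_indicator \<sigma> \<omega> \<omega>' * G \<omega>')"
    unfolding determined_by_def fibre_indicator_def
    using determined_byD[OF assms(1)] determined_byD[OF assms(2)] by (metis (full_types))
  from expect_cond_mult[OF this, of F] show ?thesis
    by (simp add: cond_def ac_simps)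
qed

lemma cond_mult_determined:
  assumes "determined_by \<sigma> G" "\<omega> \<in> \<Omega>"
  shows "cond \<sigma> (\<lambda>\<omega>. G \<omega> * F \<omega>) \<omega> = G \<omega> * cond \<sigma> F \<omega>"
proof -
  have "expect (\<lambda>\<omega>'. fibre_indicator \<sigma> \<omega> \<omega>' * (G \<omega>' * F \<omega>')) = expect (\<lambda>\<omega>'. G \<omega> * (fibre_indicator \<sigma> \<omega> \<omega>' * F \<omega>'))"
  proof (rule expect_cong)
    fix \<omega>' assume "\<omega>' \<in> \<Omega>"
    then show "fibre_indicator \<sigma> \<omega> \<omega>' * (G \<omega>' * F \<omega>') = G \<omega> * (fibre_indicator \<sigma> \<omega> \<omega>' * F \<omega>')"
      using determined_byD[OF assms(1) \<open>\<omega>' \<in> \<Omega>\<close> assms(2)]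
      by (cases "\<sigma> \<omega>' = \<sigma> \<omega>") (simp_all add: fibre_indicator_def)
  qed
  then show ?thesis
    by (simp add: cond_def expect_cmult)
qed

text \<open>
  Conditional expectations are orthogonal projections onto nested spaces, so the energy gained by the
  finer one is exactly the mean square of the change.
\<close>
lemma expect_cond_diff_square:
  assumes "determined_by \<tau> \<sigma>"
  shows "expect (\<lambda>\<omega>. (cond \<tau> F \<omega> - cond \<sigma> F \<omega>)\<^sup>2)
      = expect (\<lambda>\<omega>. (cond \<tau> F \<omega>)\<^sup>2) - expect (\<lambda>\<omega>. (cond \<sigma> F \<omega>)\<^sup>2)"
proof -
  have "expect (\<lambda>\<omega>. cond \<tau> F \<omega> * cond \<sigma> F \<omega>) = expect (\<lambda>\<omega>. F \<omega> * cond \<sigma> F \<omega>)"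
    by (rule expect_cond_mult[OF determined_by_cond[OF assms]])
  also have "\<dots> = expect (\<lambda>\<omega>. (cond \<sigma> F \<omega>)\<^sup>2)"
    using expect_cond_mult[OF determined_by_cond[of \<sigma> \<sigma>], of F F]
    by (simp add: determined_by_def power2_eq_square)
  finally have *: "expect (\<lambda>\<omega>. cond \<tau> F \<omega> * cond \<sigma> F \<omega>) = expect (\<lambda>\<omega>. (cond \<sigma> F \<omega>)\<^sup>2)" .
  have "expect (\<lambda>\<omega>. (cond \<tau> F \<omega> - cond \<sigma> F \<omega>)\<^sup>2)
      = expect (\<lambda>\<omega>. (cond \<tau> F \<omega>)\<^sup>2 + (cond \<sigma> F \<omega>)\<^sup>2 - 2 * (cond \<tau> F \<omega> * cond \<sigma> F \<omega>))"
    by (simp add: power2_diff mult.assoc)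
  then show ?thesis
    by (simp add: expect_add expect_diff expect_cmult *)
qed

text \<open>
  Conditionally on \<open>\<sigma>\<close>, a bounded \<open>G\<close> is nearly uncorrelated with \<open>F\<close> as soon as learning everything that
  \<open>G\<close> depends on changes the prediction of \<open>F\<close> only slightly: the covariance is the conditional expectation
  of this change times \<open>G\<close>. The free parameter \<open>l\<close> takes the place of the square root in the
  Cauchy--Schwarz inequality; the bound is then linear in the mean square and can be summed over many
  pairs \<open>F\<close>, \<open>G\<close> before \<open>l\<close> is chosen.
\<close>
lemma cond_covariance_le:
  assumes fine: "determined_by \<tau> \<sigma>" "determined_by \<tau> G"
    and bound: "\<And>\<omega>. \<omega> \<in> \<Omega> \<Longrightarrow> \<bar>G \<omega>\<bar> \<le> 1" and "0 < l"
  shows "expect (\<lambda>\<omega>. \<bar>cond \<sigma> (\<lambda>\<omega>. F \<omega> * G \<omega>) \<omega> - cond \<sigma> F \<omega> * cond \<sigma> G \<omega>\<bar>)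
      \<le> (l + expect (\<lambda>\<omega>. (cond \<tau> F \<omega> - cond \<sigma> F \<omega>)\<^sup>2) / l) / 2"
proof -
  let ?D = "\<lambda>\<omega>. cond \<tau> F \<omega> - cond \<sigma> F \<omega>"
  have "expect (\<lambda>\<omega>. \<bar>cond \<sigma> (\<lambda>\<omega>. F \<omega> * G \<omega>) \<omega> - cond \<sigma> F \<omega> * cond \<sigma> G \<omega>\<bar>)
      \<le> expect (cond \<sigma> (\<lambda>\<omega>. \<bar>?D \<omega>\<bar>))"
  proof (rule expect_mono)
    fix \<omega> assume \<omega>: "\<omega> \<in> \<Omega>"
    have "cond \<sigma> (\<lambda>\<omega>. F \<omega> * G \<omega>) \<omega> - cond \<sigma> F \<omega> * cond \<sigma> G \<omega>
        = cond \<sigma> (\<lambda>\<omega>. cond \<tau> F \<omega> * G \<omega>) \<omega> - cond \<sigma> (\<lambda>\<omega>. cond \<sigma> F \<omega> * G \<omega>) \<omega>"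
      using cond_mult_determined[OF determined_by_cond[of \<sigma> \<sigma>] \<omega>, of F G] cond_cond_mult[OF fine, of F \<omega>]
      by (simp add: determined_by_def)
    also have "\<dots> = cond \<sigma> (\<lambda>\<omega>. ?D \<omega> * G \<omega>) \<omega>"
      by (simp add: cond_diff left_diff_distrib)
    finally have "\<bar>cond \<sigma> (\<lambda>\<omega>. F \<omega> * G \<omega>) \<omega> - cond \<sigma> F \<omega> * cond \<sigma> G \<omega>\<bar>
        \<le> cond \<sigma> (\<lambda>\<omega>. \<bar>?D \<omega> * G \<omega>\<bar>) \<omega>"
      using cond_abs_le[OF \<omega>] by simp
    also have "\<dots> \<le> cond \<sigma> (\<lambda>\<omega>. \<bar>?D \<omega>\<bar>) \<omega>"
      by (rule cond_mono[OF _ \<omega>]) (use bound in \<open>auto simp: abs_mult intro!: mult_left_le\<close>)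
    finally show "\<bar>cond \<sigma> (\<lambda>\<omega>. F \<omega> * G \<omega>) \<omega> - cond \<sigma> F \<omega> * cond \<sigma> G \<omega>\<bar>
        \<le> cond \<sigma> (\<lambda>\<omega>. \<bar>?D \<omega>\<bar>) \<omega>" .
  qed
  also have "\<dots> = expect (\<lambda>\<omega>. \<bar>?D \<omega>\<bar>)"
    by (rule expect_cond)
  also have "\<dots> \<le> expect (\<lambda>\<omega>. l / 2 + (1 / (2 * l)) * (?D \<omega>)\<^sup>2)"
  proof (rule expect_mono)
    fix \<omega>
    have "a \<le> l / 2 + (1 / (2 * l)) * a\<^sup>2" for a
    proof -
      have "0 \<le> (a - l)\<^sup>2 / (2 * l)" using \<open>0 < l\<close> by simp
      also have "(a - l)\<^sup>2 / (2 * l) = l / 2 + (1 / (2 * l)) * a\<^sup>2 - a"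
        using \<open>0 < l\<close> by (simp add: field_simps power2_eq_square)
      finally show ?thesis by simp
    qed
    from this[of "\<bar>?D \<omega>\<bar>"] show "\<bar>?D \<omega>\<bar> \<le> l / 2 + (1 / (2 * l)) * (?D \<omega>)\<^sup>2"
      by simp
  qed
  also have "\<dots> = (l + expect (\<lambda>\<omega>. (?D \<omega>)\<^sup>2) / l) / 2"
    by (simp only: expect_add expect_const expect_cmult add_divide_distrib) simp
  finally show ?thesis .
qed

text \<open>
  Relative entropy is nonnegative, because \<open>ln u \<le> u - 1\<close>.
\<close>
lemma gibbs_inequality:
  assumes "\<And>\<omega>. \<omega> \<in> \<Omega> \<Longrightarrow> 0 < \<rho> \<omega>" "sum \<rho> \<Omega> \<le> 1"
  shows "expect (\<lambda>\<omega>. ln (\<rho> \<omega>)) \<le> expect (\<lambda>\<omega>. ln (\<mu> \<omega>))"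
proof -
  have "expect (\<lambda>\<omega>. ln (\<rho> \<omega>) - ln (\<mu> \<omega>)) \<le> expect (\<lambda>\<omega>. \<rho> \<omega> / \<mu> \<omega> - 1)"
  proof (rule expect_mono)
    fix \<omega> assume "\<omega> \<in> \<Omega>"
    with assms(1) weight_pos have "0 < \<rho> \<omega>" "0 < \<mu> \<omega>" by auto
    then show "ln (\<rho> \<omega>) - ln (\<mu> \<omega>) \<le> \<rho> \<omega> / \<mu> \<omega> - 1"
      using ln_le_minus_one[of "\<rho> \<omega> / \<mu> \<omega>"] by (simp add: ln_div)
  qed
  also have "\<dots> = (\<Sum>\<omega>\<in>\<Omega>. \<mu> \<omega> * (\<rho> \<omega> / \<mu> \<omega>)) - 1"
    by (simp only: expect_diff expect_const expect_def)
  also have "(\<Sum>\<omega>\<in>\<Omega>. \<mu> \<omega> * (\<rho> \<omega> / \<mu> \<omega>)) = sum \<rho> \<Omega>"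
  proof (intro sum.cong refl)
    fix \<omega> assume "\<omega> \<in> \<Omega>"
    then have "\<mu> \<omega> \<noteq> 0" using weight_pos by force
    then show "\<mu> \<omega> * (\<rho> \<omega> / \<mu> \<omega>) = \<rho> \<omega>" by simp
  qed
  finally show ?thesis
    using assms(2) by (simp add: expect_diff)
qed

end

section \<open>Product Bernoulli measures and the Gibbs variational bound\<close>

text \<open>
  The probability of \<open>S\<close> when every \<open>p \<in> P\<close> is included independently with probability \<open>x p\<close>.
\<close>
definition bern :: "'b set \<Rightarrow> ('b \<Rightarrow> real) \<Rightarrow> 'b set \<Rightarrow> real" where
  "bern P x S = (\<Prod>p\<in>S. x p) * (\<Prod>p\<in>P - S. 1 - x p)"

definition neg_entropy :: "real \<Rightarrow> real" where
  "neg_entropy y = y * ln y + (1 - y) * ln (1 - y)"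

lemma prod_if_split:
  fixes a b :: "'b \<Rightarrow> real"
  assumes "finite P" "S \<subseteq> P"
  shows "(\<Prod>p\<in>P. if p \<in> S then a p else b p) = (\<Prod>p\<in>S. a p) * (\<Prod>p\<in>P - S. b p)"
  using prod.If_cases[OF assms(1), of "\<lambda>p. p \<in> S" a b] assms(2)
  by (simp add: Int_absorb1 Diff_eq)

lemma bern_eq_prod:
  assumes "finite P" "S \<subseteq> P"
  shows "bern P x S = (\<Prod>p\<in>P. if p \<in> S then x p else 1 - x p)"
  by (simp add: bern_def prod_if_split[OF assms])

text \<open>
  Independence in the form of a generating function: the product over \<open>P\<close> of the sums of two terms
  expands into a sum over the sets \<open>S\<close> of elements that contribute their first term.
\<close>
lemma bern_expect_prod:
  fixes a b x :: "'b \<Rightarrow> real"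
  assumes "finite P"
  shows "(\<Sum>S\<in>Pow P. bern P x S * (\<Prod>p\<in>P. if p \<in> S then a p else b p))
      = (\<Prod>p\<in>P. x p * a p + (1 - x p) * b p)"
proof -
  have "bern P x S * (\<Prod>p\<in>P. if p \<in> S then a p else b p)
      = (\<Prod>p\<in>S. x p * a p) * (\<Prod>p\<in>P - S. (1 - x p) * b p)" if "S \<in> Pow P" for S
    using that by (simp add: bern_def prod_if_split[OF assms] prod.distrib)
  then show ?thesis
    by (simp add: prod_add[OF assms])
qed

lemma sum_bern: "finite P \<Longrightarrow> (\<Sum>S\<in>Pow P. bern P x S) = 1"
  using bern_expect_prod[of P x "\<lambda>_. 1" "\<lambda>_. 1"] by simp

lemma bern_nonneg:
  assumes "\<And>p. p \<in> P \<Longrightarrow> x p \<in> {0..1}" "S \<subseteq> P"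
  shows "0 \<le> bern P x S"
  unfolding bern_def by (intro mult_nonneg_nonneg prod_nonneg) (use assms in force)+

locale gibbs =
  fixes P :: "'b set" and \<Omega> :: "'b set set" and f :: "'b set \<Rightarrow> real"
  assumes finite_ground: "finite P" and config: "\<Omega> \<subseteq> Pow P" and nonempty: "\<Omega> \<noteq> {}"
begin

definition Z :: real where "Z = (\<Sum>S\<in>\<Omega>. exp (f S))"

definition weight :: "'b set \<Rightarrow> real" where "weight S = exp (f S) / Z"

lemma finite_config: "finite \<Omega>"
  using config finite_ground by (simp add: finite_subset)

lemma Z_pos: "0 < Z"
  unfolding Z_def using finite_config nonempty by (intro sum_pos) auto

sublocale finite_prob \<Omega> weight
proof
  show "sum weight \<Omega> = 1"
    unfolding weight_def sum_divide_distrib[symmetric] Z_def[symmetric] using Z_pos by simp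
qed (use finite_config Z_pos in \<open>auto simp: weight_def\<close>)

text \<open>
  The Gibbs variational principle with side information \<open>\<sigma>\<close>. The comparison weight \<open>\<rho>\<close> of \<open>S\<close> is the product
  weight of \<open>S\<close> for the conditional means given \<open>\<sigma> S\<close>, divided by the number of values of \<open>\<sigma>\<close>. On each
  fibre it is a fixed product measure, so its total mass is at most \<open>1\<close> and \<open>gibbs_inequality\<close> applies;
  the expectation of \<open>ln \<rho>\<close> is the mean-field entropy because the means are determined by \<open>\<sigma>\<close>.
\<close>
lemma mean_field_bound:
  fixes \<sigma> :: "'b set \<Rightarrow> 'c"
  defines "x \<equiv> \<lambda>S p. cond \<sigma> (\<lambda>T. of_bool (p \<in> T)) S"
  shows "ln Z \<le> ln (card (\<sigma> ` \<Omega>)) + expect (\<lambda>S. f S - (\<Sum>p\<in>P. neg_entropy (x S p)))"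
proof -
  define K where "K = real (card (\<sigma> ` \<Omega>))"
  have "0 < K"
    using nonempty finite_config by (simp add: K_def card_gt_0_iff)
  have unit: "x S p \<in> {0..1}" if "S \<in> \<Omega>" for S p
    unfolding x_def by (rule cond_in_unit[OF _ that]) auto
  have mem_pos: "0 < x S p" if "S \<in> \<Omega>" "p \<in> S" for S p
    unfolding x_def cond_def
  proof (rule divide_pos_pos[OF _ fibre_mass_pos[OF that(1)]])
    show "0 < expect (\<lambda>T. fibre_indicator \<sigma> S T * of_bool (p \<in> T))"
      unfolding expect_def by (rule sum_pos2[of _ S])
        (use that finite_config weight_pos in \<open>auto simp: fibre_indicator_def less_imp_le\<close>)
  qed
  have nonmem_less: "x S p < 1" if "S \<in> \<Omega>" "p \<notin> S" for S p
  proof -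
    have "1 - x S p = cond \<sigma> (\<lambda>T. 1 - of_bool (p \<in> T)) S"
      by (simp only: cond_diff cond_const[OF that(1)] x_def)
    also have "\<dots> > 0"
      unfolding cond_def
    proof (rule divide_pos_pos[OF _ fibre_mass_pos[OF that(1)]])
      show "0 < expect (\<lambda>T. fibre_indicator \<sigma> S T * (1 - of_bool (p \<in> T)))"
        unfolding expect_def by (rule sum_pos2[of _ S])
          (use that finite_config weight_pos in \<open>auto simp: fibre_indicator_def less_imp_le\<close>)
    qed
    finally show ?thesis by simp
  qed
  define \<rho> where "\<rho> S = bern P (x S) S / K" for S
  have factor_pos: "0 < (if p \<in> S then x S p else 1 - x S p)" if "S \<in> \<Omega>" for S p
    using mem_pos[OF that] nonmem_less[OF that] by simp
  have bern_pos: "0 < bern P (x S) S" if "S \<in> \<Omega>" for S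
    using that config factor_pos[OF that] by (simp add: bern_eq_prod[OF finite_ground] subset_iff prod_pos)
  have "(\<Sum>S\<in>\<Omega>. bern P (x S) S) = (\<Sum>c\<in>\<sigma> ` \<Omega>. \<Sum>S\<in>{S \<in> \<Omega>. \<sigma> S = c}. bern P (x S) S)"
    by (rule sum.image_gen[OF finite_config])
  also have "\<dots> \<le> (\<Sum>c\<in>\<sigma> ` \<Omega>. 1)"
  proof (rule sum_mono)
    fix c assume "c \<in> \<sigma> ` \<Omega>"
    then obtain S0 where S0: "S0 \<in> \<Omega>" "c = \<sigma> S0" by auto
    have "(\<Sum>S\<in>{S \<in> \<Omega>. \<sigma> S = c}. bern P (x S) S) = (\<Sum>S\<in>{S \<in> \<Omega>. \<sigma> S = c}. bern P (x S0) S)"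
    proof (rule sum.cong[OF refl])
      fix S assume "S \<in> {S \<in> \<Omega>. \<sigma> S = c}"
      with S0 have "x S = x S0" unfolding x_def by (auto intro!: ext cond_determined)
      then show "bern P (x S) S = bern P (x S0) S" by simp
    qed
    also have "\<dots> \<le> (\<Sum>S\<in>Pow P. bern P (x S0) S)"
      by (rule sum_mono2) (use finite_ground config unit[OF S0(1)] in \<open>auto intro!: bern_nonneg\<close>)
    finally show "(\<Sum>S\<in>{S \<in> \<Omega>. \<sigma> S = c}. bern P (x S) S) \<le> 1"
      by (simp add: sum_bern finite_ground)
  qed
  finally have "(\<Sum>S\<in>\<Omega>. bern P (x S) S) \<le> K" by (simp add: K_def)
  then have sub: "sum \<rho> \<Omega> \<le> 1"
    using \<open>0 < K\<close> by (simp add: \<rho>_def sum_divide_distrib[symmetric])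
  have "expect (\<lambda>S. ln (\<rho> S)) \<le> expect (\<lambda>S. ln (weight S))"
    by (rule gibbs_inequality[OF _ sub]) (use bern_pos \<open>0 < K\<close> in \<open>simp add: \<rho>_def\<close>)
  also have "\<dots> = expect f - ln Z"
    using Z_pos by (simp add: weight_def ln_div expect_diff expect_const)
  finally have 1: "expect (\<lambda>S. ln (\<rho> S)) \<le> expect f - ln Z" .
  have "expect (\<lambda>S. ln (\<rho> S))
      = expect (\<lambda>S. (\<Sum>p\<in>P. of_bool (p \<in> S) * ln (x S p) + (1 - of_bool (p \<in> S)) * ln (1 - x S p)) - ln K)"
  proof (rule expect_cong)
    fix S assume S: "S \<in> \<Omega>"
    have "ln (bern P (x S) S) = (\<Sum>p\<in>P. ln (if p \<in> S then x S p else 1 - x S p))"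
    proof -
      have "bern P (x S) S = (\<Prod>p\<in>P. if p \<in> S then x S p else 1 - x S p)"
        using S config by (intro bern_eq_prod[OF finite_ground]) auto
      moreover have "(if p \<in> S then x S p else 1 - x S p) \<noteq> 0" for p
        using factor_pos[OF S, of p] by linarith
      then have "ln (\<Prod>p\<in>P. if p \<in> S then x S p else 1 - x S p)
          = (\<Sum>p\<in>P. ln (if p \<in> S then x S p else 1 - x S p))"
        by (rule ln_prod[OF finite_ground])
      ultimately show ?thesis by (simp only:)
    qed
    also have "\<dots> = (\<Sum>p\<in>P. of_bool (p \<in> S) * ln (x S p) + (1 - of_bool (p \<in> S)) * ln (1 - x S p))"
      by (rule sum.cong) auto
    finally show "ln (\<rho> S) = (\<Sum>p\<in>P. of_bool (p \<in> S) * ln (x S p) + (1 - of_bool (p \<in> S)) * ln (1 - x S p)) - ln K"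
      using bern_pos[OF S] \<open>0 < K\<close> by (simp add: \<rho>_def ln_div)
  qed
  also have "\<dots> = (\<Sum>p\<in>P. expect (\<lambda>S. of_bool (p \<in> S) * ln (x S p))
      + (expect (\<lambda>S. ln (1 - x S p)) - expect (\<lambda>S. of_bool (p \<in> S) * ln (1 - x S p)))) - ln K"
    by (simp only: expect_diff expect_const expect_sum expect_add left_diff_distrib mult_1_left)
  also have "\<dots> = (\<Sum>p\<in>P. expect (\<lambda>S. x S p * ln (x S p))
      + (expect (\<lambda>S. ln (1 - x S p)) - expect (\<lambda>S. x S p * ln (1 - x S p)))) - ln K"
  proof -
    have det: "determined_by \<sigma> (\<lambda>S. g (x S p))" for g :: "real \<Rightarrow> real" and p
      unfolding determined_by_def x_def by (metis cond_determined)
    have "expect (\<lambda>S. of_bool (p \<in> S) * g (x S p)) = expect (\<lambda>S. x S p * g (x S p))"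
      for g :: "real \<Rightarrow> real" and p
      using expect_cond_mult[OF det, of "\<lambda>T. of_bool (p \<in> T)" g p] by (simp add: x_def)
    from this[of _ ln] this[of _ "\<lambda>y. ln (1 - y)"] show ?thesis by simp
  qed
  also have "\<dots> = expect (\<lambda>S. \<Sum>p\<in>P. neg_entropy (x S p)) - ln K"
    by (simp only: expect_diff expect_sum expect_add left_diff_distrib mult_1_left neg_entropy_def)
  finally show ?thesis
    using 1 by (simp add: expect_diff K_def)
qed

end

section \<open>Revealing the stars of a few vertices\<close>

text \<open>
  If every list of length less than \<open>w\<close> had an extension gaining more than \<open>M / w\<close>, then \<open>w\<close> such
  extensions would push \<open>\<Phi>\<close> above its bound \<open>M\<close>. Hence for some short list no extension gains that much,
  in particular not the average one.
\<close>
lemma energy_increment: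
  fixes \<Phi> :: "'a list \<Rightarrow> real"
  assumes V: "finite V" and range: "\<And>vs. \<Phi> vs \<in> {0..M}" and "0 < w"
  obtains vs where "length vs < w" "(\<Sum>v\<in>V. \<Phi> (v # vs) - \<Phi> vs) \<le> real (card V) * (M / real w)"
proof -
  have "\<exists>vs. length vs < w \<and> (\<Sum>v\<in>V. \<Phi> (v # vs) - \<Phi> vs) \<le> real (card V) * (M / real w)"
  proof (rule ccontr)
    assume none: "\<not> ?thesis"
    have step: "\<exists>v\<in>V. \<Phi> (v # vs) - \<Phi> vs > M / real w" if "length vs < w" for vs
    proof (rule ccontr)
      assume "\<not> ?thesis"
      then have "(\<Sum>v\<in>V. \<Phi> (v # vs) - \<Phi> vs) \<le> (\<Sum>v\<in>V. M / real w)"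
        by (intro sum_mono) (auto simp: not_less)
      with none that show False by auto
    qed
    have climb: "\<exists>vs. length vs = m \<and> real m * (M / real w) \<le> \<Phi> vs" if "m < w" for m
      using that
    proof (induction m)
      case 0
      have "0 \<le> \<Phi> []" using range[of "[]"] by simp
      then show ?case by (intro exI[of _ "[]"]) simp
    next
      case (Suc m)
      then obtain vs where vs: "length vs = m" "real m * (M / real w) \<le> \<Phi> vs" by auto
      with step[of vs] Suc.prems obtain v where "\<Phi> (v # vs) - \<Phi> vs > M / real w" by auto
      moreover have "real (Suc m) * (M / real w) = real m * (M / real w) + M / real w"
        by (simp add: distrib_right del: times_divide_eq_right)
      ultimately show ?case
        using vs by (intro exI[of _ "v # vs"]) auto
    qed
    obtain vs where vs: "length vs = w - 1" "real (w - 1) * (M / real w) \<le> \<Phi> vs"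
      using climb[of "w - 1"] \<open>0 < w\<close> by auto
    with step[of vs] \<open>0 < w\<close> obtain v where "\<Phi> (v # vs) - \<Phi> vs > M / real w" by auto
    then have "\<Phi> (v # vs) > real (w - 1) * (M / real w) + M / real w"
      using vs by linarith
    also have "real (w - 1) * (M / real w) + M / real w = M"
      using \<open>0 < w\<close> by (simp add: of_nat_diff field_simps)
    finally show False using range[of "v # vs"] by simp
  qed
  then show ?thesis using that by auto
qed

text \<open>
  Under a uniformly random map \<open>q\<close> the value \<open>q u\<close> is uniform and independent of the other values. A
  quantity that does not look at \<open>q u\<close> may therefore be paired with \<open>q u\<close> itself in place of a fresh
  uniform element.
\<close>
lemma sum_PiE_resample:
  fixes \<psi> :: "('a \<Rightarrow> 'b) \<Rightarrow> 'b \<Rightarrow> real"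
  assumes "finite V" "u \<in> V" "finite A"
    and invariant: "\<And>q v a. \<psi> (q(u := a)) v = \<psi> q v"
  shows "(\<Sum>v\<in>A. \<Sum>q\<in>V \<rightarrow>\<^sub>E A. \<psi> q v) = real (card A) * (\<Sum>q\<in>V \<rightarrow>\<^sub>E A. \<psi> q (q u))"
proof -
  have split: "(\<Sum>q\<in>V \<rightarrow>\<^sub>E A. g q) = (\<Sum>a\<in>A. \<Sum>q\<in>(V - {u}) \<rightarrow>\<^sub>E A. g (q(u := a)))" for g :: "('a \<Rightarrow> 'b) \<Rightarrow> real"
  proof -
    have "V \<rightarrow>\<^sub>E A = (\<lambda>(y, q). q(u := y)) ` (A \<times> ((V - {u}) \<rightarrow>\<^sub>E A))"
      using PiE_insert_eq[of u "V - {u}" "\<lambda>_. A"] assms(2) by (simp add: insert_absorb)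
    moreover have "inj_on (\<lambda>(y, q). q(u := y)) (A \<times> ((V - {u}) \<rightarrow>\<^sub>E A))"
      by (rule inj_combinator) simp
    ultimately show ?thesis
      by (simp add: sum.reindex sum.cartesian_product case_prod_unfold)
  qed
  show ?thesis
    unfolding split by (simp add: invariant sum.swap[of _ _ A] sum_distrib_left)
qed

definition indic :: "(nat \<times> nat) set \<Rightarrow> nat \<times> nat \<Rightarrow> real" where
  "indic S p = of_bool (p \<in> S)"

definition edge_prod :: "('a \<times> 'a) set \<Rightarrow> ('a \<Rightarrow> nat) \<Rightarrow> (nat \<times> nat \<Rightarrow> real) \<Rightarrow> real" where
  "edge_prod D q x = (\<Prod>(l, l')\<in>D. coord x (q l) (q l'))"

lemma coord_commute: "coord x i j = coord x j i"
  by (simp add: coord_def)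

lemma coord_in_unit: "(\<And>p. x p \<in> {0..1}) \<Longrightarrow> coord x i j \<in> {0..1}"
  by (simp add: coord_def)

lemma indic_in_unit: "indic S p \<in> {0..1}"
  by (simp add: indic_def)

lemma edge_prod_in_unit:
  assumes "\<And>p. x p \<in> {0..1}"
  shows "edge_prod D q x \<in> {0..1}"
  using prod_mono[of D "\<lambda>_. 0" "\<lambda>(l, l'). coord x (q l) (q l')"] coord_in_unit[OF assms]
    prod_le_1[of D "\<lambda>(l, l'). coord x (q l) (q l')"]
  unfolding edge_prod_def by (auto intro!: prod_nonneg)

locale random_graph = finite_prob \<Omega> \<mu>
  for \<Omega> :: "(nat \<times> nat) set set" and \<mu> +
  fixes N :: nat
begin

definition star :: "(nat \<times> nat) set \<Rightarrow> nat \<Rightarrow> nat set" where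
  "star S v = {u \<in> {1..N}. coord (indic S) v u = 1}"

definition stars :: "nat list \<Rightarrow> (nat \<times> nat) set \<Rightarrow> nat set list" where
  "stars vs S = map (star S) vs"

definition mean :: "nat list \<Rightarrow> (nat \<times> nat) set \<Rightarrow> nat \<times> nat \<Rightarrow> real" where
  "mean vs S p = cond (stars vs) (\<lambda>T. indic T p) S"

definition pattern_mean :: "nat list \<Rightarrow> ('a \<times> 'a) set \<Rightarrow> ('a \<Rightarrow> nat) \<Rightarrow> (nat \<times> nat) set \<Rightarrow> real" where
  "pattern_mean vs D q S = cond (stars vs) (\<lambda>T. edge_prod D q (indic T)) S"

lemma stars_refine: "determined_by (stars (v # vs)) (stars vs)"
  by (simp add: determined_by_def stars_def)

lemma stars_determine_coord:
  assumes "u \<in> {1..N}"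
  shows "determined_by (stars (v # vs)) (\<lambda>S. coord (indic S) v u)"
  unfolding determined_by_def
proof (intro ballI impI)
  fix S S' assume "stars (v # vs) S = stars (v # vs) S'"
  then have "star S v = star S' v" by (simp add: stars_def)
  then have "(coord (indic S) v u = 1) = (coord (indic S') v u = 1)"
    using assms by (auto simp: star_def)
  then show "coord (indic S) v u = coord (indic S') v u"
    by (auto simp: coord_def indic_def split: if_splits)
qed

lemma card_stars_le: "card (stars vs ` \<Omega>) \<le> (2 ^ N) ^ length vs"
proof -
  have "stars vs ` \<Omega> \<subseteq> {xs. set xs \<subseteq> Pow {1..N} \<and> length xs = length vs}"
    by (auto simp: stars_def star_def)
  then have "card (stars vs ` \<Omega>) \<le> card {xs. set xs \<subseteq> Pow {1..N} \<and> length xs = length vs}"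
    by (intro card_mono finite_lists_length_eq) auto
  then show ?thesis
    by (simp add: card_lists_length_eq card_Pow)
qed

lemma coord_mean:
  assumes "S \<in> \<Omega>"
  shows "coord (mean vs S) i j = cond (stars vs) (\<lambda>T. coord (indic T) i j) S"
  using cond_const[OF assms, of "stars vs" 0] by (simp add: coord_def mean_def)

lemma mean_in_unit: "S \<in> \<Omega> \<Longrightarrow> mean vs S p \<in> {0..1}"
  unfolding mean_def by (rule cond_in_unit) (rule indic_in_unit)

text \<open>
  Induction on the number of edges. Of two different edges, one has an endpoint \<open>u\<close> that the other has
  not; so \<open>u\<close> splits \<open>D\<close> into two smaller parts, the edges \<open>D1\<close> at \<open>u\<close> and the edges \<open>D2\<close> avoiding \<open>u\<close>. The
  product over \<open>D1\<close> is determined by the star of \<open>q u\<close>, while the product over \<open>D2\<close> does not look at \<open>q u\<close>, so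
  by \<open>sum_PiE_resample\<close> the star of \<open>q u\<close> acts like that of a random vertex and by assumption tells
  little about \<open>D2\<close>. Each split thus costs one covariance error, and a pattern with \<open>d\<close> edges needs \<open>d - 1\<close>
  splits.
\<close>
lemma edge_prod_mean_factor:
  fixes D :: "('a :: linorder \<times> 'a) set"
  assumes "finite D" "D \<subseteq> E"
    and E: "\<And>l l'. (l, l') \<in> E \<Longrightarrow> l < l' \<and> l \<in> V \<and> l' \<in> V"
    and V: "finite V" and "0 < \<delta>" "0 < N"
    and small: "\<And>D. D \<subseteq> E \<Longrightarrow> (\<Sum>v\<in>{1..N}. \<Sum>q\<in>V \<rightarrow>\<^sub>E {1..N}.
        expect (\<lambda>S. (pattern_mean (v # vs) D q S - pattern_mean vs D q S)\<^sup>2))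
        \<le> real N * (real N ^ card V * \<delta>)"
  shows "(\<Sum>q\<in>V \<rightarrow>\<^sub>E {1..N}. expect (\<lambda>S. \<bar>pattern_mean vs D q S - edge_prod D q (mean vs S)\<bar>))
      \<le> real (card D - 1) * (real N ^ card V * sqrt \<delta>)"
  using assms(1,2)
proof (induction "card D" arbitrary: D rule: less_induct)
  case less
  let ?Q = "V \<rightarrow>\<^sub>E {1..N}"
  let ?err = "\<lambda>D q. expect (\<lambda>S. \<bar>pattern_mean vs D q S - edge_prod D q (mean vs S)\<bar>)"
  show ?case
  proof (cases "\<exists>d\<in>D. \<exists>d'\<in>D. d \<noteq> d'")
    case False
    have "?err D q = expect (\<lambda>_. 0)" for q
    proof (rule expect_cong)
      fix S assume S: "S \<in> \<Omega>"
      from False have "D = {} \<or> (\<exists>l l'. D = {(l, l')})" by (metis equals0I is_singletonI' is_singletonE surj_pair)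
      then show "\<bar>pattern_mean vs D q S - edge_prod D q (mean vs S)\<bar> = 0"
        using S by (auto simp: pattern_mean_def edge_prod_def cond_const coord_mean)
    qed
    then show ?thesis
      using \<open>0 < \<delta>\<close> by (simp add: expect_const)
  next
    case True
    then obtain l l' m m' where ends: "(l, l') \<in> D" "(m, m') \<in> D" "(l, l') \<noteq> (m, m')" by auto
    with less.prems E have "l < l'" "m < m'" by auto
    with ends(3) have "\<not> ({l, l'} \<subseteq> {m, m'} \<and> {m, m'} \<subseteq> {l, l'})" by auto
    with ends obtain u where u: "\<exists>d\<in>D. u \<in> {fst d, snd d}" "\<exists>d\<in>D. u \<notin> {fst d, snd d}"
      by (metis fst_conv snd_conv subsetI)
    define D1 where "D1 = {d \<in> D. u \<in> {fst d, snd d}}"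
    define D2 where "D2 = {d \<in> D. u \<notin> {fst d, snd d}}"
    have D12: "D = D2 \<union> D1" "D2 \<inter> D1 = {}" "D1 \<noteq> {}" "D2 \<noteq> {}" "D1 \<subseteq> E" "D2 \<subseteq> E"
      unfolding D1_def D2_def using u less.prems(2) by blast+
    have fin: "finite D1" "finite D2"
      unfolding D1_def D2_def using less.prems(1) by simp_all
    have "u \<in> V"
      using \<open>D1 \<noteq> {}\<close> \<open>D1 \<subseteq> E\<close> E by (auto simp: D1_def)
    have card_D: "card D = card D2 + card D1" "0 < card D1" "0 < card D2"
      using D12 fin by (auto simp: card_Un_disjoint card_gt_0_iff)
    have split: "edge_prod D q x = edge_prod D2 q x * edge_prod D1 q x" for q x
      unfolding edge_prod_def D12(1) by (rule prod.union_disjoint) (use fin D12 in auto)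
    let ?cov = "\<lambda>q. expect (\<lambda>S. \<bar>pattern_mean vs D q S - pattern_mean vs D2 q S * pattern_mean vs D1 q S\<bar>)"
    let ?jump = "\<lambda>q v. expect (\<lambda>S. (pattern_mean (v # vs) D2 q S - pattern_mean vs D2 q S)\<^sup>2)"
    have unit: "pattern_mean vs D' q S \<in> {0..1}" if "S \<in> \<Omega>" for D' q S
      unfolding pattern_mean_def by (rule cond_in_unit[OF _ that]) (rule edge_prod_in_unit[OF indic_in_unit])
    have triangle: "?err D q \<le> ?cov q + (?err D2 q + ?err D1 q)" for q
      unfolding expect_add[symmetric]
    proof (rule expect_mono)
      fix S assume S: "S \<in> \<Omega>"
      let ?p = "\<lambda>D. pattern_mean vs D q S" and ?e = "\<lambda>D. edge_prod D q (mean vs S)"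
      have "?p D - ?e D = (?p D - ?p D2 * ?p D1) + (?p D1 * (?p D2 - ?e D2) + ?e D2 * (?p D1 - ?e D1))"
        by (simp add: split algebra_simps)
      moreover have "\<bar>?p D1 * (?p D2 - ?e D2)\<bar> \<le> \<bar>?p D2 - ?e D2\<bar>"
        using unit[OF S, of D1 q] by (simp add: abs_mult mult_left_le_one_le)
      moreover have "\<bar>?e D2 * (?p D1 - ?e D1)\<bar> \<le> \<bar>?p D1 - ?e D1\<bar>"
        using edge_prod_in_unit[of "mean vs S" D2 q, OF mean_in_unit[OF S]]
        by (simp add: abs_mult mult_left_le_one_le)
      ultimately show "\<bar>?p D - ?e D\<bar> \<le> \<bar>?p D - ?p D2 * ?p D1\<bar> + (\<bar>?p D2 - ?e D2\<bar> + \<bar>?p D1 - ?e D1\<bar>)"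
        by linarith
    qed
    have cov: "?cov q \<le> (sqrt \<delta> + ?jump q (q u) / sqrt \<delta>) / 2" if q: "q \<in> ?Q" for q
      unfolding pattern_mean_def split
    proof (rule cond_covariance_le[OF stars_refine])
      have one: "determined_by (stars (q u # vs)) (\<lambda>S. coord (indic S) (q a) (q b))"
        if ab: "(a, b) \<in> D1" for a b
      proof -
        from ab D12(5) E have "a \<in> V" "b \<in> V" by auto
        then have "q a \<in> {1..N}" "q b \<in> {1..N}" by (simp_all only: PiE_mem[OF q])
        with ab show ?thesis
          using stars_determine_coord[of "q a" "q u" vs] stars_determine_coord[of "q b" "q u" vs]
          by (auto simp: D1_def coord_commute[of _ "q a" "q b"])
      qed
      show "determined_by (stars (q u # vs)) (\<lambda>S. edge_prod D1 q (indic S))"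
        unfolding determined_by_def edge_prod_def
      proof (intro ballI impI prod.cong refl)
        fix S S' d assume "S \<in> \<Omega>" "S' \<in> \<Omega>" "stars (q u # vs) S = stars (q u # vs) S'" "d \<in> D1"
        then show "(case d of (a, b) \<Rightarrow> coord (indic S) (q a) (q b)) = (case d of (a, b) \<Rightarrow> coord (indic S') (q a) (q b))"
          by (cases d) (simp, rule determined_byD[OF one])
      qed
      show "\<bar>edge_prod D1 q (indic S)\<bar> \<le> 1" for S
        using edge_prod_in_unit[of "indic S" D1 q, OF indic_in_unit] by simp
    qed (use \<open>0 < \<delta>\<close> in simp)
    have resample: "real N * (\<Sum>q\<in>?Q. ?jump q (q u)) = (\<Sum>v\<in>{1..N}. \<Sum>q\<in>?Q. ?jump q v)"
    proof -
      have "edge_prod D2 (q(u := a)) x = edge_prod D2 q x" for q a x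
        unfolding edge_prod_def by (rule prod.cong) (auto simp: D2_def)
      then show ?thesis
        using sum_PiE_resample[OF V \<open>u \<in> V\<close>, of "{1..N}" ?jump] by (simp add: pattern_mean_def)
    qed
    also have "\<dots> \<le> real N * (real N ^ card V * \<delta>)"
      by (rule small[OF \<open>D2 \<subseteq> E\<close>])
    finally have jump: "(\<Sum>q\<in>?Q. ?jump q (q u)) \<le> real N ^ card V * \<delta>"
      using \<open>0 < N\<close> by simp
    have "(\<Sum>q\<in>?Q. ?cov q) \<le> (\<Sum>q\<in>?Q. (sqrt \<delta> + ?jump q (q u) / sqrt \<delta>) / 2)"
      by (rule sum_mono) (rule cov)
    also have "\<dots> = (real N ^ card V * sqrt \<delta> + (\<Sum>q\<in>?Q. ?jump q (q u)) / sqrt \<delta>) / 2"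
      by (simp add: sum.distrib sum_divide_distrib[symmetric] card_funcsetE[OF V])
    also have "\<dots> \<le> (real N ^ card V * sqrt \<delta> + real N ^ card V * \<delta> / sqrt \<delta>) / 2"
      using jump \<open>0 < \<delta>\<close> by (intro divide_right_mono add_left_mono) auto
    also have "\<dots> = real N ^ card V * sqrt \<delta>"
      using \<open>0 < \<delta>\<close> by (simp add: real_div_sqrt flip: times_divide_eq_right)
    finally have cov_sum: "(\<Sum>q\<in>?Q. ?cov q) \<le> real N ^ card V * sqrt \<delta>" .
    have "(\<Sum>q\<in>?Q. ?err D q) \<le> (\<Sum>q\<in>?Q. ?cov q) + ((\<Sum>q\<in>?Q. ?err D2 q) + (\<Sum>q\<in>?Q. ?err D1 q))"
      unfolding sum.distrib[symmetric] by (rule sum_mono) (rule triangle)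
    also have "\<dots> \<le> real N ^ card V * sqrt \<delta> + (real (card D2 - 1) * (real N ^ card V * sqrt \<delta>)
        + real (card D1 - 1) * (real N ^ card V * sqrt \<delta>))"
      using less.hyps[of D1] less.hyps[of D2] card_D D12 fin by (intro add_mono cov_sum) auto
    also have "\<dots> = real (card D - 1) * (real N ^ card V * sqrt \<delta>)"
      using card_D by (simp add: of_nat_diff algebra_simps)
    finally show ?thesis .
  qed
qed

text \<open>
  The energy increment argument for all subpatterns at once: the energies, each normalized by the number
  of placements \<open>q\<close>, add up to at most the number \<open>M\<close> of subpatterns, and by
  \<open>expect_cond_diff_square\<close> every single increment is nonnegative, so a bound for their sum bounds
  each of them.
\<close>
lemma exists_stabilizing_stars:
  fixes V :: "'r \<Rightarrow> 'a set" and E :: "'r \<Rightarrow> ('a \<times> 'a) set"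
  assumes "finite R" "\<And>r. r \<in> R \<Longrightarrow> finite (V r)" "\<And>r. r \<in> R \<Longrightarrow> finite (E r)" "0 < N" "0 < w"
  defines "M \<equiv> \<Sum>r\<in>R. 2 ^ card (E r) :: real"
  obtains vs where "length vs < w"
    "\<And>r D. r \<in> R \<Longrightarrow> D \<subseteq> E r \<Longrightarrow> (\<Sum>v\<in>{1..N}. \<Sum>q\<in>V r \<rightarrow>\<^sub>E {1..N}.
        expect (\<lambda>S. (pattern_mean (v # vs) D q S - pattern_mean vs D q S)\<^sup>2))
        \<le> real N * (real N ^ card (V r) * (M / real w))"
proof -
  define en where "en vs r D q = expect (\<lambda>S. (pattern_mean vs D q S)\<^sup>2)" for vs and r :: 'r and D and q :: "'a \<Rightarrow> nat"
  define \<Phi> where "\<Phi> vs = (\<Sum>r\<in>R. \<Sum>D\<in>Pow (E r). (\<Sum>q\<in>V r \<rightarrow>\<^sub>E {1..N}. en vs r D q) / real N ^ card (V r))" for vs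
  have en: "0 \<le> en vs r D q" "en vs r D q \<le> 1" for vs r D q
  proof -
    have unit: "pattern_mean vs D q S \<in> {0..1}" if "S \<in> \<Omega>" for S
      unfolding pattern_mean_def by (rule cond_in_unit[OF _ that]) (rule edge_prod_in_unit[OF indic_in_unit])
    show "0 \<le> en vs r D q"
      using expect_mono[of "\<lambda>_. 0" "\<lambda>S. (pattern_mean vs D q S)\<^sup>2"] by (simp add: en_def expect_const)
    show "en vs r D q \<le> 1"
      using expect_mono[of "\<lambda>S. (pattern_mean vs D q S)\<^sup>2" "\<lambda>_. 1"] unit
      by (auto simp: en_def expect_const power_le_one)
  qed
  have range: "\<Phi> vs \<in> {0..M}" for vs
  proof -
    have "0 \<le> \<Phi> vs"
      unfolding \<Phi>_def by (intro sum_nonneg divide_nonneg_nonneg en) auto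
    moreover have "\<Phi> vs \<le> (\<Sum>r\<in>R. \<Sum>D\<in>Pow (E r). 1)"
      unfolding \<Phi>_def
    proof (intro sum_mono)
      fix r D assume r: "r \<in> R"
      have "(\<Sum>q\<in>V r \<rightarrow>\<^sub>E {1..N}. en vs r D q) \<le> (\<Sum>q\<in>V r \<rightarrow>\<^sub>E {1..N}. 1)"
        by (intro sum_mono en)
      also have "\<dots> = real N ^ card (V r)"
        using assms(2)[OF r] by (simp add: card_funcsetE)
      finally show "(\<Sum>q\<in>V r \<rightarrow>\<^sub>E {1..N}. en vs r D q) / real N ^ card (V r) \<le> 1"
        using \<open>0 < N\<close> by simp
    qed
    ultimately show ?thesis
      using assms(3) by (simp add: M_def card_Pow)
  qed
  obtain vs where vs: "length vs < w"
      "(\<Sum>v\<in>{1..N}. \<Phi> (v # vs) - \<Phi> vs) \<le> real (card {1..N}) * (M / real w)"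
    by (rule energy_increment[OF finite_atLeastAtMost range \<open>0 < w\<close>])
  define jump where "jump v r D = (\<Sum>q\<in>V r \<rightarrow>\<^sub>E {1..N}.
    expect (\<lambda>S. (pattern_mean (v # vs) D q S - pattern_mean vs D q S)\<^sup>2))" for v r D
  have jump_nonneg: "0 \<le> jump v r D" for v r D
    unfolding jump_def
  proof (rule sum_nonneg)
    show "0 \<le> expect (\<lambda>S. (pattern_mean (v # vs) D q S - pattern_mean vs D q S)\<^sup>2)" for q
      using expect_mono[of "\<lambda>_. 0" "\<lambda>S. (pattern_mean (v # vs) D q S - pattern_mean vs D q S)\<^sup>2"]
      by (simp add: expect_const)
  qed
  have "\<Phi> (v # vs) - \<Phi> vs = (\<Sum>r\<in>R. \<Sum>D\<in>Pow (E r). jump v r D / real N ^ card (V r))" for v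
    unfolding \<Phi>_def sum_subtractf[symmetric] diff_divide_distrib[symmetric] jump_def en_def pattern_mean_def
      expect_cond_diff_square[OF stars_refine] by simp
  then have total: "(\<Sum>v\<in>{1..N}. \<Sum>r\<in>R. \<Sum>D\<in>Pow (E r). jump v r D / real N ^ card (V r)) \<le> real N * (M / real w)"
    using vs(2) by simp
  show ?thesis
  proof (rule that[OF vs(1)])
    fix r D assume rD: "r \<in> R" "D \<subseteq> E r"
    have "(\<Sum>v\<in>{1..N}. jump v r D / real N ^ card (V r))
        \<le> (\<Sum>v\<in>{1..N}. \<Sum>r\<in>R. \<Sum>D\<in>Pow (E r). jump v r D / real N ^ card (V r))"
    proof (rule sum_mono)
      fix v
      have "jump v r D / real N ^ card (V r) \<le> (\<Sum>D\<in>Pow (E r). jump v r D / real N ^ card (V r))"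
        by (rule member_le_sum) (use rD assms(3) jump_nonneg in auto)
      also have "\<dots> \<le> (\<Sum>r\<in>R. \<Sum>D\<in>Pow (E r). jump v r D / real N ^ card (V r))"
        by (rule member_le_sum[of r R "\<lambda>r. \<Sum>D\<in>Pow (E r). jump v r D / real N ^ card (V r)"])
          (use rD assms(1) jump_nonneg in \<open>auto intro!: sum_nonneg\<close>)
      finally show "jump v r D / real N ^ card (V r) \<le> (\<Sum>r\<in>R. \<Sum>D\<in>Pow (E r). jump v r D / real N ^ card (V r))" .
    qed
    also note total
    finally have "(\<Sum>v\<in>{1..N}. jump v r D) / real N ^ card (V r) \<le> real N * (M / real w)"
      by (simp add: sum_divide_distrib)
    then have "(\<Sum>v\<in>{1..N}. jump v r D) \<le> real N * (M / real w) * real N ^ card (V r)"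
      using \<open>0 < N\<close> by (subst (asm) pos_divide_le_eq) auto
    then show "(\<Sum>v\<in>{1..N}. \<Sum>q\<in>V r \<rightarrow>\<^sub>E {1..N}.
        expect (\<lambda>S. (pattern_mean (v # vs) D q S - pattern_mean vs D q S)\<^sup>2))
        \<le> real N * (real N ^ card (V r) * (M / real w))"
      by (simp only: jump_def mult.assoc mult.commute[of "M / real w"])
  qed
qed

end

section \<open>Homomorphism counts as edge polynomials\<close>

lemma finite_index_pairs: "finite (index_pairs N)"
  by (rule finite_subset[of _ "{1..N} \<times> {1..N}"]) (auto simp: index_pairs_def)

lemma I_fun_eq: "I_fun N x = (\<Sum>p\<in>index_pairs N. neg_entropy (x p))"
  by (simp add: I_fun_def neg_entropy_def)
definition edge_pairs :: "nat sgraph \<Rightarrow> (nat \<times> nat) set" where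
  "edge_pairs H = {(l, l'). l < l' \<and> {l, l'} \<in> eset H}"

lemma edge_pairs_in: "simple_graph H \<Longrightarrow> (l, l') \<in> edge_pairs H \<Longrightarrow> l < l' \<and> l \<in> vset H \<and> l' \<in> vset H"
  unfolding edge_pairs_def simple_graph_def by blast

lemma finite_edge_pairs:
  assumes "simple_graph H"
  shows "finite (edge_pairs H)"
proof (rule finite_subset)
  show "edge_pairs H \<subseteq> vset H \<times> vset H"
    using edge_pairs_in[OF assms] by auto
  show "finite (vset H \<times> vset H)"
    using assms by (simp add: simple_graph_def)
qed

text \<open>
  Multiplied by the number \<open>N ^ card (vset H)\<close> of placements, this is \<open>N\<^sup>2\<close>.
\<close>
definition T_scale :: "nat \<Rightarrow> nat sgraph \<Rightarrow> real" where
  "T_scale N H = 1 / real N powi (int (card (vset H)) - 2)"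

lemma T_fun_eq: "T_fun N H x = T_scale N H * (\<Sum>q\<in>vset H \<rightarrow>\<^sub>E {1..N}. edge_prod (edge_pairs H) q x)"
  by (simp add: T_fun_def T_scale_def edge_prod_def edge_pairs_def)

lemma T_scale_pos: "0 < N \<Longrightarrow> 0 < T_scale N H"
  by (simp add: T_scale_def)

lemma T_scale_power: "0 < N \<Longrightarrow> T_scale N H * real N ^ card (vset H) = real N ^ 2"
  by (simp add: T_scale_def power_int_diff)

lemma T_fun_cong:
  assumes "simple_graph H" "\<And>p. p \<in> index_pairs N \<Longrightarrow> x p = y p"
  shows "T_fun N H x = T_fun N H y"
proof -
  have "coord x (q l) (q l') = coord y (q l) (q l')"
    if "q \<in> vset H \<rightarrow>\<^sub>E {1..N}" "(l, l') \<in> edge_pairs H" for q l l'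
  proof -
    have "q l \<in> {1..N}" "q l' \<in> {1..N}"
      using edge_pairs_in[OF assms(1) that(2)] PiE_mem[OF that(1)] by simp_all
    then show ?thesis
      using assms(2) by (auto simp: coord_def index_pairs_def)
  qed
  then show ?thesis
    unfolding T_fun_eq edge_prod_def by (intro arg_cong2[where f = "(*)"] sum.cong prod.cong refl) auto
qed

lemma edge_pairs_single_edge: "edge_pairs single_edge = {(1, 2)}"
  by (auto simp: edge_pairs_def single_edge_def doubleton_eq_iff)

lemma simple_single_edge: "simple_graph single_edge"
  by (simp add: simple_graph_def single_edge_def)

context random_graph
begin

text \<open>
  The edge count is a linear function of the edge indicators. This is why revealing information keeps
  the conditional means inside the window.
\<close>
lemma T_fun_single_edge_mean:
  assumes "S \<in> \<Omega>"
  shows "T_fun N single_edge (mean vs S) = cond (stars vs) (\<lambda>T. T_fun N single_edge (indic T)) S"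
  by (simp add: T_fun_eq edge_prod_def edge_pairs_single_edge coord_mean[OF assms] cond_cmult cond_sum)

lemma expect_T_fun_mean:
  assumes H: "simple_graph H" and "0 < \<delta>" "0 < N"
    and small: "\<And>D. D \<subseteq> edge_pairs H \<Longrightarrow> (\<Sum>v\<in>{1..N}. \<Sum>q\<in>vset H \<rightarrow>\<^sub>E {1..N}.
        expect (\<lambda>S. (pattern_mean (v # vs) D q S - pattern_mean vs D q S)\<^sup>2))
        \<le> real N * (real N ^ card (vset H) * \<delta>)"
  shows "\<bar>expect (\<lambda>S. T_fun N H (indic S)) - expect (\<lambda>S. T_fun N H (mean vs S))\<bar>
      \<le> real (card (edge_pairs H)) * sqrt \<delta> * real N ^ 2"
proof -
  let ?Q = "vset H \<rightarrow>\<^sub>E {1..N}" and ?D = "edge_pairs H"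
  have "expect (\<lambda>S. T_fun N H (indic S)) - expect (\<lambda>S. T_fun N H (mean vs S))
      = T_scale N H * (\<Sum>q\<in>?Q. expect (\<lambda>S. pattern_mean vs ?D q S - edge_prod ?D q (mean vs S)))"
    by (simp add: T_fun_eq expect_cmult expect_sum expect_diff pattern_mean_def expect_cond sum_subtractf
        right_diff_distrib)
  also have "\<bar>\<dots>\<bar> \<le> T_scale N H * (\<Sum>q\<in>?Q. expect (\<lambda>S. \<bar>pattern_mean vs ?D q S - edge_prod ?D q (mean vs S)\<bar>))"
    using T_scale_pos[OF \<open>0 < N\<close>, of H]
    by (auto simp: abs_mult intro!: mult_left_mono order_trans[OF sum_abs sum_mono[OF expect_abs_le]])
  also have "\<dots> \<le> T_scale N H * (real (card ?D - 1) * (real N ^ card (vset H) * sqrt \<delta>))"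
    by (intro mult_left_mono edge_prod_mean_factor[OF finite_edge_pairs[OF H] order_refl])
      (use T_scale_pos[OF \<open>0 < N\<close>, of H] assms edge_pairs_in[OF H] in \<open>auto simp: simple_graph_def\<close>)
  also have "\<dots> = real (card ?D - 1) * sqrt \<delta> * real N ^ 2"
    unfolding T_scale_power[OF \<open>0 < N\<close>, of H, symmetric] by simp
  also have "\<dots> \<le> real (card ?D) * sqrt \<delta> * real N ^ 2"
    using \<open>0 < \<delta>\<close> by (intro mult_right_mono) auto
  finally show ?thesis .
qed

end

section \<open>The conditional partition function as a sum over edge sets\<close>

definition graph_of :: "nat \<Rightarrow> (nat \<times> nat) set \<Rightarrow> nat sgraph" where
  "graph_of N S = ({1..N}, (\<lambda>(i, j). {i, j}) ` S)"

definition config :: "real \<Rightarrow> nat \<Rightarrow> real \<Rightarrow> (nat \<times> nat) set set" where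
  "config e N t = {S \<in> Pow (index_pairs N). \<bar>T_fun N single_edge (indic S) - real N ^ 2 * e\<bar> \<le> real N ^ 2 * t}"

lemma coord_indic:
  assumes "S \<subseteq> index_pairs N"
  shows "coord (indic S) a b = of_bool ({a, b} \<in> eset (graph_of N S))"
proof -
  have lt: "i < j" if "(i, j) \<in> S" for i j
    using assms that by (auto simp: index_pairs_def)
  have "{a, b} \<in> eset (graph_of N S) \<longleftrightarrow> (a, b) \<in> S \<or> (b, a) \<in> S"
    by (auto simp: graph_of_def doubleton_eq_iff image_iff)
  then show ?thesis
    using lt[of a b] lt[of b a] by (auto simp: coord_def indic_def)
qed

lemma bij_betw_graph_of: "bij_betw (graph_of N) (Pow (index_pairs N)) (graphs_on N)"
proof (rule bij_betwI[where g = edge_pairs])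
  show "graph_of N \<in> Pow (index_pairs N) \<rightarrow> graphs_on N"
  proof (rule funcsetI)
    fix S assume "S \<in> Pow (index_pairs N)"
    then have "1 \<le> i \<and> i < j \<and> j \<le> N" if "(i, j) \<in> S" for i j
      using that by (auto simp: index_pairs_def)
    then have "d \<subseteq> {1..N} \<and> card d = 2" if "d \<in> (\<lambda>(i, j). {i, j}) ` S" for d
      using that by (fastforce simp: card_2_iff)
    then show "graph_of N S \<in> graphs_on N"
      by (simp add: graph_of_def graphs_on_def simple_graph_def)
  qed
  show "edge_pairs \<in> graphs_on N \<rightarrow> Pow (index_pairs N)"
  proof (rule funcsetI)
    fix G assume "G \<in> graphs_on N"
    then have "simple_graph G" "vset G = {1..N}" by (auto simp: graphs_on_def)
    then show "edge_pairs G \<in> Pow (index_pairs N)"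
      using edge_pairs_in[of G] by (auto simp: index_pairs_def)
  qed
  show "edge_pairs (graph_of N S) = S" if "S \<in> Pow (index_pairs N)" for S
  proof -
    have "i < j" if "(i, j) \<in> S" for i j
      using \<open>S \<in> Pow (index_pairs N)\<close> that by (auto simp: index_pairs_def)
    then show ?thesis
      by (force simp: edge_pairs_def graph_of_def doubleton_eq_iff image_iff)
  qed
  show "graph_of N (edge_pairs G) = G" if "G \<in> graphs_on N" for G
  proof (rule prod_eqI)
    show "vset (graph_of N (edge_pairs G)) = vset G"
      using that by (simp add: graph_of_def graphs_on_def)
    have "d \<in> eset (graph_of N (edge_pairs G))" if d: "d \<in> eset G" for d
    proof -
      have "card d = 2" using \<open>G \<in> graphs_on N\<close> d by (simp add: graphs_on_def simple_graph_def)
      then obtain a b where "d = {a, b}" "a < b"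
        by (metis card_2_iff insert_commute neqE)
      then show ?thesis
        using d by (auto simp: graph_of_def edge_pairs_def intro!: image_eqI[of _ _ "(a, b)"])
    qed
    then show "eset (graph_of N (edge_pairs G)) = eset G"
      by (auto simp: graph_of_def edge_pairs_def)
  qed
qed

text \<open>
  At a 0-1 vector the edge product of a placement is the indicator of its being a homomorphism.
\<close>
lemma hom_density_graph_of:
  assumes H: "simple_graph H" and S: "S \<subseteq> index_pairs N" and "0 < N"
  shows "real N ^ 2 * hom_density H (graph_of N S) = T_fun N H (indic S)"
proof -
  let ?Q = "vset H \<rightarrow>\<^sub>E {1..N}" and ?G = "graph_of N S"
  have fin: "finite ?Q"
    using H by (simp add: finite_PiE simple_graph_def)
  have hom: "hom_set H ?G = {q \<in> ?Q. \<forall>(l, l')\<in>edge_pairs H. {q l, q l'} \<in> eset ?G}"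
  proof -
    have "{q u, q v} \<in> eset ?G"
      if all: "\<forall>(l, l')\<in>edge_pairs H. {q l, q l'} \<in> eset ?G" and uv: "{u, v} \<in> eset H" for q u v
    proof -
      have "u \<noteq> v" using H uv by (auto simp: simple_graph_def)
      then have "(u, v) \<in> edge_pairs H \<or> (v, u) \<in> edge_pairs H"
        using uv by (auto simp: edge_pairs_def insert_commute)
      then show ?thesis using all by (auto simp: insert_commute)
    qed
    then show ?thesis
      by (auto simp: hom_set_def graph_of_def edge_pairs_def)
  qed
  have "edge_prod (edge_pairs H) q (indic S) = of_bool (\<forall>(l, l')\<in>edge_pairs H. {q l, q l'} \<in> eset ?G)" for q
  proof (cases "\<forall>(l, l')\<in>edge_pairs H. {q l, q l'} \<in> eset ?G")
    case True
    then show ?thesis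
      by (auto simp: edge_prod_def coord_indic[OF S] intro!: prod.neutral)
  next
    case False
    then obtain l l' where "(l, l') \<in> edge_pairs H" "coord (indic S) (q l) (q l') = 0"
      by (auto simp: coord_indic[OF S])
    then have "edge_prod (edge_pairs H) q (indic S) = 0"
      unfolding edge_prod_def by (intro prod_zero[OF finite_edge_pairs[OF H]] bexI[of _ "(l, l')"]) simp_all
    with False show ?thesis by (simp only: of_bool_eq)
  qed
  then have "(\<Sum>q\<in>?Q. edge_prod (edge_pairs H) q (indic S)) = real (card (hom_set H ?G))"
    unfolding hom using fin by (simp add: sum.If_cases of_bool_def Int_def)
  moreover have "hom_density H ?G = real (card (hom_set H ?G)) / real N ^ card (vset H)"
    by (simp add: hom_density_def graph_of_def)
  ultimately show ?thesis
    using \<open>0 < N\<close> by (simp add: T_fun_eq T_scale_power[symmetric, of N H])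
qed

lemma cond_psi_eq:
  assumes H: "\<And>r. r \<in> {1..s} \<Longrightarrow> simple_graph (H r)" and "0 < N"
  shows "cond_psi s H e \<zeta> N t = (if config e N t = {} then - \<infinity> else
    ereal (1 / real N ^ 2 * ln (\<Sum>S\<in>config e N t. exp (\<Sum>r = 1..s. \<zeta> r * T_fun N (H r) (indic S)))))"
proof -
  have inj: "inj_on (graph_of N) (config e N t)"
    by (rule inj_on_subset[OF bij_betw_imp_inj_on[OF bij_betw_graph_of]]) (auto simp: config_def)
  have "\<bar>edge_density (graph_of N S) - e\<bar> \<le> t
      \<longleftrightarrow> \<bar>T_fun N single_edge (indic S) - real N ^ 2 * e\<bar> \<le> real N ^ 2 * t" if "S \<subseteq> index_pairs N" for S
  proof -
    have "T_fun N single_edge (indic S) - real N ^ 2 * e = real N ^ 2 * (edge_density (graph_of N S) - e)"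
      using hom_density_graph_of[OF simple_single_edge that \<open>0 < N\<close>]
      by (simp add: edge_density_def right_diff_distrib)
    then show ?thesis
      using \<open>0 < N\<close> by (simp add: abs_mult)
  qed
  then have graphs: "cond_graphs e N t = graph_of N ` config e N t"
    unfolding cond_graphs_def config_def bij_betw_imp_surj_on[OF bij_betw_graph_of, symmetric] by auto
  have "real N ^ 2 * (\<Sum>r = 1..s. \<zeta> r * hom_density (H r) (graph_of N S))
      = (\<Sum>r = 1..s. \<zeta> r * T_fun N (H r) (indic S))" if "S \<in> config e N t" for S
    unfolding sum_distrib_left
    by (rule sum.cong) (use that hom_density_graph_of[OF H _ \<open>0 < N\<close>] in \<open>auto simp: config_def mult.left_commute\<close>)
  then have "(\<Sum>G\<in>cond_graphs e N t. exp (real N ^ 2 * (\<Sum>r = 1..s. \<zeta> r * hom_density (H r) G)))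
      = (\<Sum>S\<in>config e N t. exp (\<Sum>r = 1..s. \<zeta> r * T_fun N (H r) (indic S)))"
    unfolding graphs sum.reindex[OF inj] by (simp add: o_def)
  then show ?thesis
    by (simp add: cond_psi_def graphs)
qed

section \<open>The upper bound\<close>

text \<open>
  The upper bound for fixed \<open>N\<close>: the point \<open>x\<close> is the vector of conditional edge probabilities for a
  favourable outcome of the revealed stars. The loss is the number of bits revealed plus the error of
  factorizing the patterns.
\<close>
lemma ln_partition_le:
  fixes \<zeta> :: "nat \<Rightarrow> real"
  assumes H: "\<And>r. r \<in> {1..s} \<Longrightarrow> simple_graph (H r)" and "1 \<le> s" "0 < N" "0 < w"
    and \<Omega>: "\<Omega> \<subseteq> Pow (index_pairs N)" "\<Omega> \<noteq> {}"
    and edges: "\<And>r. r \<in> {1..s} \<Longrightarrow> real (card (edge_pairs (H r))) \<le> a"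
    and window: "\<And>S. S \<in> \<Omega> \<Longrightarrow> \<bar>T_fun N single_edge (indic S) - b\<bar> \<le> L"
  defines "F \<equiv> \<lambda>x. \<Sum>r = 1..s. \<zeta> r * T_fun N (H r) x"
    and "M \<equiv> \<Sum>r = 1..s. 2 ^ card (edge_pairs (H r)) :: real"
  obtains x where "x \<in> cube N" "\<bar>T_fun N single_edge x - b\<bar> \<le> L"
    "ln (\<Sum>S\<in>\<Omega>. exp (F (indic S)))
      \<le> F x - I_fun N x + real w * real N * ln 2 + (\<Sum>r = 1..s. \<bar>\<zeta> r\<bar>) * (a * sqrt (M / real w) * real N ^ 2)"
proof -
  interpret gibbs "index_pairs N" \<Omega> "\<lambda>S. F (indic S)"
    by unfold_locales (use \<Omega> finite_index_pairs in auto)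
  interpret random_graph \<Omega> weight N ..
  have "0 < M"
    unfolding M_def using \<open>1 \<le> s\<close> by (intro sum_pos) auto
  have fin: "finite {1..s}" "\<And>r. r \<in> {1..s} \<Longrightarrow> finite (vset (H r))" "\<And>r. r \<in> {1..s} \<Longrightarrow> finite (edge_pairs (H r))"
    using H finite_edge_pairs by (auto simp: simple_graph_def)
  obtain vs where vs: "length vs < w" and small: "\<And>r D. r \<in> {1..s} \<Longrightarrow> D \<subseteq> edge_pairs (H r) \<Longrightarrow>
      (\<Sum>v\<in>{1..N}. \<Sum>q\<in>vset (H r) \<rightarrow>\<^sub>E {1..N}.
        expect (\<lambda>S. (pattern_mean (v # vs) D q S - pattern_mean vs D q S)\<^sup>2))
        \<le> real N * (real N ^ card (vset (H r)) * (M / real w))"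
    unfolding M_def by (rule exists_stabilizing_stars[OF fin \<open>0 < N\<close> \<open>0 < w\<close>]) blast+
  let ?x = "\<lambda>S. mean vs S"
  define err where "err = (\<Sum>r = 1..s. \<bar>\<zeta> r\<bar>) * (a * sqrt (M / real w) * real N ^ 2)"
  have expect_F: "expect (\<lambda>S. F (g S)) = (\<Sum>r = 1..s. \<zeta> r * expect (\<lambda>S. T_fun N (H r) (g S)))" for g
  proof -
    have "expect (\<lambda>S. F (g S)) = expect (\<lambda>S. \<Sum>r = 1..s. \<zeta> r * T_fun N (H r) (g S))"
      by (rule expect_cong) (simp add: F_def)
    then show ?thesis by (simp only: expect_sum expect_cmult)
  qed
  have "expect (\<lambda>S. F (indic S)) - expect (\<lambda>S. F (?x S)) =
      (\<Sum>r = 1..s. \<zeta> r * (expect (\<lambda>S. T_fun N (H r) (indic S)) - expect (\<lambda>S. T_fun N (H r) (?x S))))"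
    by (simp add: expect_F right_diff_distrib sum_subtractf)
  also have "\<dots> \<le> (\<Sum>r = 1..s. \<bar>\<zeta> r\<bar> * (a * sqrt (M / real w) * real N ^ 2))"
  proof (rule sum_mono)
    fix r assume r: "r \<in> {1..s}"
    let ?d = "expect (\<lambda>S. T_fun N (H r) (indic S)) - expect (\<lambda>S. T_fun N (H r) (?x S))"
    have "\<bar>?d\<bar> \<le> real (card (edge_pairs (H r))) * sqrt (M / real w) * real N ^ 2"
      by (rule expect_T_fun_mean[OF H[OF r] _ \<open>0 < N\<close> small[OF r]]) (use \<open>0 < M\<close> \<open>0 < w\<close> in simp)
    also have "\<dots> \<le> a * sqrt (M / real w) * real N ^ 2"
      using edges[OF r] \<open>0 < M\<close> by (intro mult_right_mono) auto
    finally have "\<bar>\<zeta> r * ?d\<bar> \<le> \<bar>\<zeta> r\<bar> * (a * sqrt (M / real w) * real N ^ 2)"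
      unfolding abs_mult by (rule mult_left_mono) simp
    then show "\<zeta> r * ?d \<le> \<bar>\<zeta> r\<bar> * (a * sqrt (M / real w) * real N ^ 2)"
      by linarith
  qed
  finally have energy: "expect (\<lambda>S. F (indic S)) \<le> expect (\<lambda>S. F (?x S)) + err"
    by (simp add: err_def sum_distrib_right)
  have "real (card (stars vs ` \<Omega>)) \<le> real ((2 ^ N) ^ length vs)"
    using card_stars_le by (simp only: of_nat_le_iff)
  then have "ln (card (stars vs ` \<Omega>)) \<le> ln (real ((2 ^ N) ^ length vs))"
    using \<Omega>(2) finite_config by (subst ln_le_cancel_iff) (auto simp: card_gt_0_iff)
  also have "\<dots> = real (length vs) * real N * ln 2"
    by (simp add: ln_realpow)
  also have "\<dots> \<le> real w * real N * ln 2"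
    using vs by (intro mult_right_mono) auto
  finally have entropy: "ln (card (stars vs ` \<Omega>)) \<le> real w * real N * ln 2" .
  have "ln Z \<le> ln (card (stars vs ` \<Omega>)) + expect (\<lambda>S. F (indic S) - I_fun N (?x S))"
    using mean_field_bound[of "stars vs"] by (simp add: I_fun_eq mean_def indic_def)
  also have "\<dots> \<le> real w * real N * ln 2 + (expect (\<lambda>S. F (?x S) - I_fun N (?x S)) + err)"
    using entropy energy by (simp add: expect_diff)
  finally have le: "ln Z \<le> real w * real N * ln 2 + (expect (\<lambda>S. F (?x S) - I_fun N (?x S)) + err)" .
  obtain S where S: "S \<in> \<Omega>" "expect (\<lambda>S. F (?x S) - I_fun N (?x S)) \<le> F (?x S) - I_fun N (?x S)"
    using expect_le_some[of "\<lambda>S. F (?x S) - I_fun N (?x S)"] by blast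
  define x where "x = restrict (?x S) (index_pairs N)"
  have T_x: "T_fun N G x = T_fun N G (?x S)" if "simple_graph G" for G
    by (rule T_fun_cong[OF that]) (simp add: x_def)
  have "x \<in> cube N"
    using mean_in_unit[OF S(1)] by (auto simp: x_def cube_def)
  moreover have "\<bar>T_fun N single_edge x - b\<bar> \<le> L"
  proof -
    have "T_fun N single_edge x - b = cond (stars vs) (\<lambda>T. T_fun N single_edge (indic T) - b) S"
      by (simp add: T_x simple_single_edge T_fun_single_edge_mean[OF S(1)] cond_diff cond_const[OF S(1)])
    also have "\<bar>\<dots>\<bar> \<le> cond (stars vs) (\<lambda>T. \<bar>T_fun N single_edge (indic T) - b\<bar>) S"
      by (rule cond_abs_le[OF S(1)])
    also have "\<dots> \<le> cond (stars vs) (\<lambda>_. L) S"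
      by (rule cond_mono[OF window S(1)])
    finally show ?thesis
      by (simp add: cond_const[OF S(1)])
  qed
  moreover have "F x = F (?x S)" "I_fun N x = I_fun N (?x S)"
    using T_x H by (simp_all add: F_def I_fun_def x_def)
  then have "ln (\<Sum>S\<in>\<Omega>. exp (F (indic S))) \<le> F x - I_fun N x + real w * real N * ln 2 + err"
    using le S(2) by (simp add: Z_def)
  ultimately show ?thesis
    by (intro that) (simp_all add: err_def)
qed

section \<open>Moments of a random edge set with independent edges\<close>

text \<open>
  Cauchy--Schwarz in the form \<open>2 l |F| \<le> l\<^sup>2 + F\<^sup>2\<close>.
\<close>
lemma (in finite_prob) expect_abs_le_square:
  assumes "expect (\<lambda>\<omega>. (F \<omega>)\<^sup>2) \<le> l\<^sup>2" "0 < l"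
  shows "expect (\<lambda>\<omega>. \<bar>F \<omega>\<bar>) \<le> l"
proof -
  have "expect (\<lambda>\<omega>. 2 * l * \<bar>F \<omega>\<bar>) \<le> expect (\<lambda>\<omega>. l\<^sup>2 + (F \<omega>)\<^sup>2)"
  proof (rule expect_mono)
    fix \<omega>
    have "0 \<le> (\<bar>F \<omega>\<bar> - l)\<^sup>2" by simp
    then show "2 * l * \<bar>F \<omega>\<bar> \<le> l\<^sup>2 + (F \<omega>)\<^sup>2" by (simp add: power2_diff algebra_simps)
  qed
  also have "\<dots> \<le> 2 * l * l"
    using assms(1) by (simp add: expect_add expect_const power2_eq_square)
  finally show ?thesis
    using \<open>0 < l\<close> by (simp add: expect_cmult)
qed

text \<open>
  Follows from \<open>- ln y = 2 ln (1 / sqrt y) \<le> 2 / sqrt y\<close>.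
\<close>
lemma mult_ln_square_le:
  fixes y :: real
  assumes "y \<in> {0..1}"
  shows "y * (ln y)\<^sup>2 \<le> 4"
proof (cases "y = 0")
  case False
  with assms have y: "0 < y" "y \<le> 1" by auto
  then have "- ln y = 2 * ln (1 / sqrt y)"
    by (simp add: ln_div ln_sqrt)
  also have "\<dots> \<le> 2 * (1 / sqrt y)"
    using ln_le_minus_one[of "1 / sqrt y"] y by simp
  finally have "(- ln y)\<^sup>2 \<le> (2 * (1 / sqrt y))\<^sup>2"
    using y by (intro power_mono) auto
  then have "(ln y)\<^sup>2 \<le> 4 / y"
    using y by (simp add: power_mult_distrib power_divide)
  then show ?thesis
    using y by (simp add: field_simps)
qed simp
locale bernoulli =
  fixes P :: "'b set" and x :: "'b \<Rightarrow> real"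
  assumes finite_ground: "finite P" and unit: "p \<in> P \<Longrightarrow> x p \<in> {0..1}"
begin

text \<open>
  Sets of weight zero, which occur when some \<open>x p\<close> is \<open>0\<close> or \<open>1\<close>, are removed to obtain a
  \<open>finite_prob\<close>.
\<close>
definition support :: "'b set set" where
  "support = {S \<in> Pow P. 0 < bern P x S}"

lemma sum_support: "(\<Sum>S\<in>support. bern P x S * F S) = (\<Sum>S\<in>Pow P. bern P x S * F S)"
proof (rule sum.mono_neutral_left)
  show "\<forall>S\<in>Pow P - support. bern P x S * F S = 0"
  proof
    fix S assume S: "S \<in> Pow P - support"
    then have "0 \<le> bern P x S" by (intro bern_nonneg unit) auto
    moreover have "\<not> 0 < bern P x S" using S by (simp add: support_def)
    ultimately show "bern P x S * F S = 0" by simp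
  qed
qed (use finite_ground in \<open>auto simp: support_def\<close>)

sublocale finite_prob support "bern P x"
proof
  show "finite support"
    using finite_ground by (simp add: support_def)
  show "sum (bern P x) support = 1"
    using sum_support[of "\<lambda>_. 1"] sum_bern[OF finite_ground, of x] by simp
qed (simp add: support_def)

lemma expect_prod:
  fixes a b :: "'b \<Rightarrow> real"
  assumes "A \<subseteq> P"
  shows "expect (\<lambda>S. \<Prod>p\<in>A. if p \<in> S then a p else b p) = (\<Prod>p\<in>A. x p * a p + (1 - x p) * b p)"
proof -
  have "(\<Prod>p\<in>A. if p \<in> S then a p else b p)
      = (\<Prod>p\<in>P. if p \<in> S then (if p \<in> A then a p else 1) else (if p \<in> A then b p else 1))" for S
    by (rule prod.mono_neutral_cong_left) (use assms finite_ground in auto)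
  moreover have "(\<Prod>p\<in>A. x p * a p + (1 - x p) * b p)
      = (\<Prod>p\<in>P. x p * (if p \<in> A then a p else 1) + (1 - x p) * (if p \<in> A then b p else 1))"
    by (rule prod.mono_neutral_cong_left) (use assms finite_ground in auto)
  ultimately show ?thesis
    by (simp only: expect_def sum_support bern_expect_prod[OF finite_ground])
qed

text \<open>
  The logarithm of the weight is a sum of independent terms, one for each \<open>p\<close>; the mean of each is
  \<open>neg_entropy (x p)\<close> and its variance is at most \<open>8\<close>, uniformly in \<open>x p\<close>.
\<close>
lemma expect_ln_bern_square:
  "expect (\<lambda>S. (ln (bern P x S) - (\<Sum>p\<in>P. neg_entropy (x p)))\<^sup>2) \<le> 8 * real (card P)"
proof -
  define a where "a p = ln (x p) - neg_entropy (x p)" for p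
  define b where "b p = ln (1 - x p) - neg_entropy (x p)" for p
  define Y where "Y p S = (if p \<in> S then a p else b p)" for p S
  have centred: "x p * a p + (1 - x p) * b p = 0" for p
    by (simp add: a_def b_def neg_entropy_def algebra_simps)
  have "ln (bern P x S) - (\<Sum>p\<in>P. neg_entropy (x p)) = (\<Sum>p\<in>P. Y p S)" if "S \<in> support" for S
  proof -
    have eq: "bern P x S = (\<Prod>p\<in>P. if p \<in> S then x p else 1 - x p)"
      using that by (intro bern_eq_prod finite_ground) (simp add: support_def)
    have "0 < bern P x S" using that by (simp add: support_def)
    then have "(if p \<in> S then x p else 1 - x p) \<noteq> 0" if "p \<in> P" for p
      unfolding eq using prod_zero[OF finite_ground, of "\<lambda>p. if p \<in> S then x p else 1 - x p"] that
      by (metis less_irrefl)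
    then have "ln (\<Prod>p\<in>P. if p \<in> S then x p else 1 - x p) = (\<Sum>p\<in>P. ln (if p \<in> S then x p else 1 - x p))"
      by (rule ln_prod[OF finite_ground])
    then have "ln (bern P x S) - (\<Sum>p\<in>P. neg_entropy (x p))
        = (\<Sum>p\<in>P. ln (if p \<in> S then x p else 1 - x p) - neg_entropy (x p))"
      by (simp only: eq sum_subtractf)
    also have "\<dots> = (\<Sum>p\<in>P. Y p S)"
      by (rule sum.cong) (auto simp: Y_def a_def b_def)
    finally show ?thesis .
  qed
  then have "expect (\<lambda>S. (ln (bern P x S) - (\<Sum>p\<in>P. neg_entropy (x p)))\<^sup>2)
      = expect (\<lambda>S. \<Sum>p\<in>P. \<Sum>p'\<in>P. Y p S * Y p' S)"
    by (intro expect_cong) (simp add: power2_eq_square sum_product)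
  also have "\<dots> = (\<Sum>p\<in>P. \<Sum>p'\<in>P. expect (\<lambda>S. Y p S * Y p' S))"
    by (simp only: expect_sum)
  also have "\<dots> \<le> (\<Sum>p\<in>P. \<Sum>p'\<in>P. if p' = p then 8 else 0)"
  proof (intro sum_mono)
    fix p p' assume p: "p \<in> P" "p' \<in> P"
    show "expect (\<lambda>S. Y p S * Y p' S) \<le> (if p' = p then 8 else 0)"
    proof (cases "p' = p")
      case True
      have "expect (\<lambda>S. Y p S * Y p S) = expect (\<lambda>S. \<Prod>p\<in>{p}. if p \<in> S then (a p)\<^sup>2 else (b p)\<^sup>2)"
        by (rule expect_cong) (simp add: Y_def power2_eq_square)
      also have "\<dots> = x p * (a p)\<^sup>2 + (1 - x p) * (b p)\<^sup>2"
        by (subst expect_prod) (use p in auto)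
      also have "\<dots> = x p * (ln (x p))\<^sup>2 + (1 - x p) * (ln (1 - x p))\<^sup>2 - (neg_entropy (x p))\<^sup>2"
        by (simp add: a_def b_def neg_entropy_def power2_eq_square algebra_simps)
      also have "\<dots> \<le> 4 + 4 - 0"
        by (intro diff_mono add_mono mult_ln_square_le) (use unit[OF p(1)] in auto)
      finally show ?thesis using True by simp
    next
      case False
      have "expect (\<lambda>S. Y p S * Y p' S) = expect (\<lambda>S. \<Prod>p\<in>{p, p'}. if p \<in> S then a p else b p)"
        by (rule expect_cong) (use False in \<open>simp add: Y_def\<close>)
      also have "\<dots> = 0"
        by (subst expect_prod) (use p False in \<open>auto simp: centred\<close>)
      finally show ?thesis using False by simp
    qed
  qed
  also have "\<dots> = 8 * real (card P)"
    by (simp add: sum.delta[OF finite_ground])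
  finally show ?thesis .
qed

end

section \<open>Second moments of homomorphism counts\<close>
text \<open>
  The image of the pattern's edges under a placement \<open>q\<close>, as coordinates of the cube: smaller endpoint
  first.
\<close>
definition edge_image :: "nat sgraph \<Rightarrow> (nat \<Rightarrow> nat) \<Rightarrow> (nat \<times> nat) set" where
  "edge_image H q = (\<lambda>(l, l'). (min (q l) (q l'), max (q l) (q l'))) ` edge_pairs H"

lemma edge_image_facts:
  assumes H: "simple_graph H" and q: "q \<in> vset H \<rightarrow>\<^sub>E {1..N}" "inj_on q (vset H)"
  shows edge_prod_eq_image: "edge_prod (edge_pairs H) q y = (\<Prod>p\<in>edge_image H q. y p)"
    and edge_image_subset: "edge_image H q \<subseteq> index_pairs N"
    and edge_image_range: "(i, j) \<in> edge_image H q \<Longrightarrow> i \<in> q ` vset H"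
proof -
  have V: "l < l'" "l \<in> vset H" "l' \<in> vset H" "q l \<noteq> q l'" "q l \<in> {1..N}" "q l' \<in> {1..N}"
    if "(l, l') \<in> edge_pairs H" for l l'
  proof -
    show "l < l'" "l \<in> vset H" "l' \<in> vset H" using edge_pairs_in[OF H that] by auto
    then show "q l \<noteq> q l'" "q l \<in> {1..N}" "q l' \<in> {1..N}"
      using inj_onD[OF q(2), of l l'] PiE_mem[OF q(1)] by auto
  qed
  have "inj_on (\<lambda>(l, l'). (min (q l) (q l'), max (q l) (q l'))) (edge_pairs H)"
  proof (rule inj_onI, clarify)
    fix a b c d
    assume ab: "(a, b) \<in> edge_pairs H" and cd: "(c, d) \<in> edge_pairs H"
      and "min (q a) (q b) = min (q c) (q d)" "max (q a) (q b) = max (q c) (q d)"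
    then have "q a = q c \<and> q b = q d \<or> q a = q d \<and> q b = q c"
      by (auto simp: min_def max_def split: if_splits)
    then have "a = c \<and> b = d \<or> a = d \<and> b = c"
      using inj_onD[OF q(2)] V[OF ab] V[OF cd] by meson
    then show "a = c \<and> b = d"
      using V(1)[OF ab] V(1)[OF cd] by auto
  qed
  then have "(\<Prod>p\<in>edge_image H q. y p) = (\<Prod>(l, l')\<in>edge_pairs H. y (min (q l) (q l'), max (q l) (q l')))"
    by (simp add: edge_image_def prod.reindex case_prod_unfold)
  also have "\<dots> = edge_prod (edge_pairs H) q y"
    unfolding edge_prod_def
    by (rule prod.cong) (auto simp: coord_def min_def max_def dest!: V(4))
  finally show "edge_prod (edge_pairs H) q y = (\<Prod>p\<in>edge_image H q. y p)" ..
  show "edge_image H q \<subseteq> index_pairs N"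
  proof
    fix p assume "p \<in> edge_image H q"
    then obtain l l' where l: "(l, l') \<in> edge_pairs H" "p = (min (q l) (q l'), max (q l) (q l'))"
      by (auto simp: edge_image_def)
    then show "p \<in> index_pairs N"
      using V(4-6)[OF l(1)] by (auto simp: index_pairs_def min_def max_def)
  qed
  show "i \<in> q ` vset H" if "(i, j) \<in> edge_image H q"
    using that V(2,3) by (auto simp: edge_image_def min_def)
qed

lemma sum_collision:
  assumes "finite V" "u \<in> V" "finite A" "c \<in> A"
  shows "real (card A) * (\<Sum>q\<in>V \<rightarrow>\<^sub>E A. of_bool (q u = c)) = real (card A) ^ card V"
proof -
  have "real (card A) * (\<Sum>q\<in>V \<rightarrow>\<^sub>E A. of_bool (q u = c)) = (\<Sum>v\<in>A. \<Sum>q\<in>V \<rightarrow>\<^sub>E A. of_bool (v = c))"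
    by (rule sum_PiE_resample[OF assms(1-3), symmetric]) simp
  also have "\<dots> = real (card (V \<rightarrow>\<^sub>E A)) * (\<Sum>v\<in>A. of_bool (v = c))"
    by (simp add: sum_distrib_left)
  also have "(\<Sum>v\<in>A. of_bool (v = c)) = (1 :: real)"
    using assms(3,4) by (simp add: of_bool_def sum.delta')
  finally show ?thesis
    by (simp add: card_funcsetE[OF assms(1)])
qed

lemma sum_self_collision:
  assumes "finite V" "u \<in> V" "u' \<in> V" "u \<noteq> u'" "finite A"
  shows "real (card A) * (\<Sum>q\<in>V \<rightarrow>\<^sub>E A. of_bool (q u = q u')) = real (card A) ^ card V"
proof -
  have "real (card A) * (\<Sum>q\<in>V \<rightarrow>\<^sub>E A. of_bool (q u = q u')) = (\<Sum>v\<in>A. \<Sum>q\<in>V \<rightarrow>\<^sub>E A. of_bool (v = q u'))"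
    by (rule sum_PiE_resample[OF assms(1,2,5), symmetric]) (use assms in simp)
  also have "\<dots> = (\<Sum>q\<in>V \<rightarrow>\<^sub>E A. \<Sum>v\<in>A. of_bool (v = q u'))"
    by (rule sum.swap)
  also have "\<dots> = (\<Sum>q\<in>V \<rightarrow>\<^sub>E A. 1)"
  proof (rule sum.cong[OF refl])
    fix q assume "q \<in> V \<rightarrow>\<^sub>E A"
    then have "q u' \<in> A" using assms(3) by (rule PiE_mem)
    then show "(\<Sum>v\<in>A. of_bool (v = q u')) = (1 :: real)"
      using assms(5) by (simp add: of_bool_def sum.delta')
  qed
  finally show ?thesis
    by (simp add: card_funcsetE[OF assms(1)])
qed

text \<open>
  Pairs of placements with a coincidence are rare: any one of the at most \<open>3 (card V)\<^sup>2\<close> possible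
  coincidences, within \<open>q\<close>, within \<open>q'\<close> or between them, has probability \<open>1 / card A\<close>.
\<close>
lemma sum_not_jointly_injective:
  fixes V :: "'a set" and A :: "'b set"
  assumes V: "finite V" and A: "finite A"
  shows "real (card A) * (\<Sum>q\<in>V \<rightarrow>\<^sub>E A. \<Sum>q'\<in>V \<rightarrow>\<^sub>E A.
      of_bool (\<not> (inj_on q V \<and> inj_on q' V \<and> q ` V \<inter> q' ` V = {})))
    \<le> 3 * real (card V) ^ 2 * real (card A) ^ (2 * card V)"
proof -
  let ?Q = "V \<rightarrow>\<^sub>E A" and ?N = "real (card A)"
  let ?self = "\<lambda>q :: 'a \<Rightarrow> 'b. \<Sum>(u, u')\<in>{(u, u') \<in> V \<times> V. u \<noteq> u'}. of_bool (q u = q u') :: real"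
  let ?meet = "\<lambda>q q' :: 'a \<Rightarrow> 'b. \<Sum>(u, u')\<in>V \<times> V. of_bool (q u = q' u') :: real"
  have fin: "finite {(u, u') \<in> V \<times> V. u \<noteq> u'}" "finite (V \<times> V)"
    using V by (auto intro: finite_subset[of _ "V \<times> V"])
  have self_nonneg: "0 \<le> ?self q" and meet_nonneg: "0 \<le> ?meet q q'" for q q'
    by (auto intro!: sum_nonneg)
  have self: "1 \<le> ?self q" if "\<not> inj_on q V" for q
  proof -
    from that obtain u u' where u: "(u, u') \<in> {(u, u') \<in> V \<times> V. u \<noteq> u'}" "q u = q u'"
      by (auto simp: inj_on_def)
    have "(case (u, u') of (u, u') \<Rightarrow> of_bool (q u = q u')) \<le> ?self q"
      by (rule member_le_sum[OF u(1) _ fin(1)]) auto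
    then show ?thesis using u(2) by simp
  qed
  have meet: "1 \<le> ?meet q q'" if "q ` V \<inter> q' ` V \<noteq> {}" for q q'
  proof -
    from that obtain u u' where u: "(u, u') \<in> V \<times> V" "q u = q' u'" by auto
    have "(case (u, u') of (u, u') \<Rightarrow> of_bool (q u = q' u')) \<le> ?meet q q'"
      by (rule member_le_sum[OF u(1) _ fin(2)]) auto
    then show ?thesis using u(2) by simp
  qed
  have card_V2: "real (card (V \<times> V)) = real (card V) ^ 2" "real (card {(u, u') \<in> V \<times> V. u \<noteq> u'}) \<le> real (card V) ^ 2"
  proof -
    show "real (card (V \<times> V)) = real (card V) ^ 2"
      by (simp add: card_cartesian_product power2_eq_square)
    moreover have "card {(u, u') \<in> V \<times> V. u \<noteq> u'} \<le> card (V \<times> V)"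
      by (rule card_mono[OF fin(2)]) auto
    ultimately show "real (card {(u, u') \<in> V \<times> V. u \<noteq> u'}) \<le> real (card V) ^ 2" by linarith
  qed
  have self_sum: "?N * (\<Sum>q\<in>?Q. ?self q) \<le> real (card V) ^ 2 * ?N ^ card V"
  proof -
    have "?N * (\<Sum>q\<in>?Q. ?self q)
        = (\<Sum>(u, u')\<in>{(u, u') \<in> V \<times> V. u \<noteq> u'}. ?N * (\<Sum>q\<in>?Q. of_bool (q u = q u')))"
      by (subst sum.swap) (simp add: case_prod_unfold sum_distrib_left)
    also have "\<dots> = (\<Sum>(u, u')\<in>{(u, u') \<in> V \<times> V. u \<noteq> u'}. ?N ^ card V)"
      using sum_self_collision[OF V _ _ _ A] by (intro sum.cong) auto
    also have "\<dots> = real (card {(u, u') \<in> V \<times> V. u \<noteq> u'}) * ?N ^ card V"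
      by (simp add: case_prod_unfold)
    also have "\<dots> \<le> real (card V) ^ 2 * ?N ^ card V"
      by (intro mult_right_mono card_V2) simp
    finally show ?thesis .
  qed
  have meet_sum: "?N * (\<Sum>q\<in>?Q. ?meet q q') = real (card V) ^ 2 * ?N ^ card V" if q': "q' \<in> ?Q" for q'
  proof -
    have "?N * (\<Sum>q\<in>?Q. ?meet q q') = (\<Sum>(u, u')\<in>V \<times> V. ?N * (\<Sum>q\<in>?Q. of_bool (q u = q' u')))"
      by (subst sum.swap) (simp add: case_prod_unfold sum_distrib_left)
    also have "\<dots> = (\<Sum>(u, u')\<in>V \<times> V. ?N ^ card V)"
      using sum_collision[OF V _ A] PiE_mem[OF q'] by (intro sum.cong) auto
    also have "\<dots> = real (card V) ^ 2 * ?N ^ card V"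
      by (simp add: case_prod_unfold card_V2(1)[symmetric])
    finally show ?thesis .
  qed
  have card_Q: "real (card ?Q) = ?N ^ card V"
    by (simp add: card_funcsetE[OF V])
  have "(\<Sum>q\<in>?Q. \<Sum>q'\<in>?Q. of_bool (\<not> (inj_on q V \<and> inj_on q' V \<and> q ` V \<inter> q' ` V = {})))
      \<le> (\<Sum>q\<in>?Q. \<Sum>q'\<in>?Q. ?self q + ?self q' + ?meet q q')"
  proof (intro sum_mono)
    fix q q'
    show "of_bool (\<not> (inj_on q V \<and> inj_on q' V \<and> q ` V \<inter> q' ` V = {})) \<le> ?self q + ?self q' + ?meet q q'"
    proof (cases "inj_on q V \<and> inj_on q' V \<and> q ` V \<inter> q' ` V = {}")
      case True
      then show ?thesis
        using add_nonneg_nonneg[OF add_nonneg_nonneg[OF self_nonneg[of q] self_nonneg[of q']] meet_nonneg[of q q']]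
        by (simp only: simp_thms of_bool_eq)
    next
      case False
      then have "1 \<le> ?self q + ?self q' + ?meet q q'"
        using self[of q] self[of q'] meet[of q q'] self_nonneg[of q] self_nonneg[of q'] meet_nonneg[of q q']
        by linarith
      then show ?thesis
        using False by (simp only: simp_thms of_bool_eq)
    qed
  qed
  also have "\<dots> = (\<Sum>q\<in>?Q. real (card ?Q) * ?self q) + (\<Sum>q'\<in>?Q. real (card ?Q) * ?self q')
      + (\<Sum>q'\<in>?Q. \<Sum>q\<in>?Q. ?meet q q')"
    by (subst (3) sum.swap) (simp only: sum.distrib sum_constant sum_distrib_left)
  finally have "?N * (\<Sum>q\<in>?Q. \<Sum>q'\<in>?Q. of_bool (\<not> (inj_on q V \<and> inj_on q' V \<and> q ` V \<inter> q' ` V = {})))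
      \<le> ?N * ((\<Sum>q\<in>?Q. real (card ?Q) * ?self q) + (\<Sum>q'\<in>?Q. real (card ?Q) * ?self q')
        + (\<Sum>q'\<in>?Q. \<Sum>q\<in>?Q. ?meet q q'))"
    by (rule mult_left_mono) simp
  also have "\<dots> = real (card ?Q) * (?N * (\<Sum>q\<in>?Q. ?self q)) + real (card ?Q) * (?N * (\<Sum>q\<in>?Q. ?self q))
      + (\<Sum>q'\<in>?Q. ?N * (\<Sum>q\<in>?Q. ?meet q q'))"
    by (simp only: distrib_left sum_distrib_left[symmetric] mult.left_commute)
  also have "\<dots> \<le> real (card ?Q) * (real (card V) ^ 2 * ?N ^ card V) + real (card ?Q) * (real (card V) ^ 2 * ?N ^ card V)
      + (\<Sum>q'\<in>?Q. real (card V) ^ 2 * ?N ^ card V)"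
  proof -
    have "(\<Sum>q'\<in>?Q. ?N * (\<Sum>q\<in>?Q. ?meet q q')) = (\<Sum>q'\<in>?Q. real (card V) ^ 2 * ?N ^ card V)"
      by (rule sum.cong[OF refl meet_sum])
    moreover have "real (card ?Q) * (?N * (\<Sum>q\<in>?Q. ?self q)) \<le> real (card ?Q) * (real (card V) ^ 2 * ?N ^ card V)"
      by (rule mult_left_mono[OF self_sum]) simp
    ultimately show ?thesis by linarith
  qed
  also have "\<dots> = 3 * (real (card V) ^ 2 * (?N ^ card V * ?N ^ card V))"
    by (simp only: card_Q sum_constant) (simp add: algebra_simps)
  also have "?N ^ card V * ?N ^ card V = ?N ^ (2 * card V)"
    by (simp only: mult_2 power_add)
  finally show ?thesis by (simp only: mult.assoc)
qed

locale bernoulli_graph =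
  fixes N :: nat and x :: "nat \<times> nat \<Rightarrow> real"
  assumes in_unit: "x p \<in> {0..1}"
begin

sublocale bernoulli "index_pairs N" x
  by unfold_locales (simp_all add: finite_index_pairs in_unit[unfolded atLeastAtMost_iff])

lemma expect_prod_indic:
  assumes "A \<subseteq> index_pairs N"
  shows "expect (\<lambda>S. \<Prod>p\<in>A. indic S p) = (\<Prod>p\<in>A. x p)"
proof -
  have "expect (\<lambda>S. \<Prod>p\<in>A. indic S p) = expect (\<lambda>S. \<Prod>p\<in>A. if p \<in> S then 1 else 0)"
    by (simp add: indic_def of_bool_def)
  then show ?thesis by (simp add: expect_prod[OF assms])
qed

text \<open>
  Two placements that are jointly injective use disjoint sets of distinct edges, so their centred edge
  products are uncorrelated; every other pair contributes at most \<open>1\<close>, and there are few of those by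
  \<open>sum_not_jointly_injective\<close>.
\<close>
lemma expect_T_fun_square:
  assumes H: "simple_graph H" and "0 < N"
  shows "expect (\<lambda>S. (T_fun N H (indic S) - T_fun N H x)\<^sup>2) \<le> 3 * real (card (vset H)) ^ 2 * real N ^ 3"
proof -
  let ?V = "vset H" and ?E = "edge_pairs H"
  let ?Q = "?V \<rightarrow>\<^sub>E {1..N}"
  let ?good = "\<lambda>q q' :: nat \<Rightarrow> nat. inj_on q ?V \<and> inj_on q' ?V \<and> q ` ?V \<inter> q' ` ?V = {}"
  define d where "d q S = edge_prod ?E q (indic S) - edge_prod ?E q x" for q S
  have "(T_fun N H (indic S) - T_fun N H x)\<^sup>2 = (T_scale N H)\<^sup>2 * (\<Sum>q\<in>?Q. \<Sum>q'\<in>?Q. d q S * d q' S)" for S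
    by (simp add: T_fun_eq d_def right_diff_distrib[symmetric] sum_subtractf[symmetric] power_mult_distrib
        power2_eq_square[of "sum _ _"] sum_product)
  then have "expect (\<lambda>S. (T_fun N H (indic S) - T_fun N H x)\<^sup>2)
      = (T_scale N H)\<^sup>2 * (\<Sum>q\<in>?Q. \<Sum>q'\<in>?Q. expect (\<lambda>S. d q S * d q' S))"
    by (simp only: expect_cmult expect_sum)
  also have "\<dots> \<le> (T_scale N H)\<^sup>2 * (\<Sum>q\<in>?Q. \<Sum>q'\<in>?Q. of_bool (\<not> ?good q q'))"
  proof (intro mult_left_mono sum_mono)
    fix q q' assume q: "q \<in> ?Q" "q' \<in> ?Q"
    show "expect (\<lambda>S. d q S * d q' S) \<le> of_bool (\<not> ?good q q')"
    proof (cases "?good q q'")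
      case True
      then have inj: "inj_on q ?V" "inj_on q' ?V" "q ` ?V \<inter> q' ` ?V = {}" by auto
      let ?K = "edge_image H q" and ?K' = "edge_image H q'"
      have K: "?K \<subseteq> index_pairs N" "?K' \<subseteq> index_pairs N"
        using edge_image_subset[OF H] q inj by blast+
      have fin: "finite ?K" "finite ?K'"
        using K finite_index_pairs by (auto intro: finite_subset)
      have disj: "?K \<inter> ?K' = {}"
        using edge_image_range[OF H q(1) inj(1)] edge_image_range[OF H q(2) inj(2)] inj(3) by fast
      have prods: "edge_prod ?E q y = (\<Prod>p\<in>?K. y p)" "edge_prod ?E q' y = (\<Prod>p\<in>?K'. y p)" for y
        using edge_prod_eq_image[OF H] q inj by blast+
      have single: "expect (\<lambda>S. edge_prod ?E q (indic S)) = edge_prod ?E q x"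
        "expect (\<lambda>S. edge_prod ?E q' (indic S)) = edge_prod ?E q' x"
        by (simp_all only: prods expect_prod_indic K)
      have "expect (\<lambda>S. edge_prod ?E q (indic S) * edge_prod ?E q' (indic S))
          = expect (\<lambda>S. \<Prod>p\<in>?K \<union> ?K'. indic S p)"
        by (simp only: prods prod.union_disjoint[OF fin disj])
      also have "\<dots> = edge_prod ?E q x * edge_prod ?E q' x"
        using K by (subst expect_prod_indic) (auto simp: prods prod.union_disjoint[OF fin disj])
      finally have joint: "expect (\<lambda>S. edge_prod ?E q (indic S) * edge_prod ?E q' (indic S))
          = edge_prod ?E q x * edge_prod ?E q' x" .
      have "d q S * d q' S = edge_prod ?E q (indic S) * edge_prod ?E q' (indic S)
          - edge_prod ?E q' x * edge_prod ?E q (indic S) - edge_prod ?E q x * edge_prod ?E q' (indic S)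
          + edge_prod ?E q x * edge_prod ?E q' x" for S
        by (simp add: d_def algebra_simps)
      then have "expect (\<lambda>S. d q S * d q' S) = 0"
        by (simp only: expect_add expect_diff expect_cmult expect_const joint single) simp
      then show ?thesis by simp
    next
      case False
      have d1: "\<bar>d q S\<bar> \<le> 1" for q S
        using edge_prod_in_unit[of "indic S" ?E q, OF indic_in_unit] edge_prod_in_unit[of x ?E q, OF in_unit]
        by (auto simp: d_def)
      have "expect (\<lambda>S. d q S * d q' S) \<le> expect (\<lambda>_. 1)"
      proof (rule expect_mono)
        fix S
        have "\<bar>d q S * d q' S\<bar> \<le> 1"
          unfolding abs_mult using d1 by (intro mult_le_one) auto
        then show "d q S * d q' S \<le> 1" by linarith
      qed
      then show ?thesis using False by (simp only: expect_const of_bool_eq simp_thms)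
    qed
  qed simp
  finally have "real N * expect (\<lambda>S. (T_fun N H (indic S) - T_fun N H x)\<^sup>2)
      \<le> (T_scale N H)\<^sup>2 * (real (card {1..N}) * (\<Sum>q\<in>?Q. \<Sum>q'\<in>?Q. of_bool (\<not> ?good q q')))"
    using \<open>0 < N\<close> by (simp add: mult.left_commute[of _ "real N"])
  also have "\<dots> \<le> (T_scale N H)\<^sup>2 * (3 * real (card ?V) ^ 2 * real (card {1..N}) ^ (2 * card ?V))"
    by (intro mult_left_mono sum_not_jointly_injective) (use H in \<open>auto simp: simple_graph_def\<close>)
  also have "\<dots> = 3 * real (card ?V) ^ 2 * (T_scale N H * real N ^ card ?V)\<^sup>2"
    by (simp add: power_mult_distrib power_mult[symmetric] mult.commute[of 2])
  also have "\<dots> = real N * (3 * real (card ?V) ^ 2 * real N ^ 3)"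
    unfolding T_scale_power[OF \<open>0 < N\<close>] by (simp add: power2_eq_square power3_eq_cube)
  finally show ?thesis
    using \<open>0 < N\<close> by simp
qed

end

section \<open>The lower bound\<close>

text \<open>
  The three deviations that matter, of the edge count (\<open>X\<close>), of \<open>F\<close> (\<open>W\<close>) and of the logarithmic
  weight (\<open>L\<close>), are added up, rescaled, to one quantity \<open>D\<close> of mean at most \<open>3 / 4\<close>. By Markov's inequality
  \<open>D \<le> 1\<close> has probability at least \<open>1 / 4\<close>, and then all three deviations are under control at once.
\<close>
lemma ln_partition_ge:
  fixes \<zeta> :: "nat \<Rightarrow> real" and K :: real
  assumes H: "\<And>r. r \<in> {1..s} \<Longrightarrow> simple_graph (H r)" and "0 < N" and x: "x \<in> cube N"
    and K: "\<And>r. r \<in> {1..s} \<Longrightarrow> real (card (vset (H r))) \<le> K" "2 \<le> K"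
    and window: "\<bar>T_fun N single_edge x - real N ^ 2 * e\<bar> \<le> real N ^ 2 * t - 8 * K * real N powr (3 / 2)"
  defines "F \<equiv> \<lambda>x. \<Sum>r = 1..s. \<zeta> r * T_fun N (H r) x" and "B \<equiv> 1 + (\<Sum>r = 1..s. \<bar>\<zeta> r\<bar>)"
  shows "config e N t \<noteq> {}"
    and "F x - I_fun N x - 22 * K * B * real N powr (3 / 2) \<le> ln (\<Sum>S\<in>config e N t. exp (F (indic S)))"
proof -
  \<comment> \<open>Outside \<open>index_pairs N\<close> the point \<open>x\<close> of the cube is \<open>undefined\<close>, which need not be a probability.\<close>
  define y where "y p = (if p \<in> index_pairs N then x p else 0)" for p
  define R where "R = real N powr (3 / 2)"
  have "R\<^sup>2 = real N ^ 3"
    using \<open>0 < N\<close> by (simp add: R_def powr_powr powr_realpow flip: powr_numeral)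
  have "real N powr 1 \<le> R"
    unfolding R_def using \<open>0 < N\<close> by (intro powr_mono) auto
  then have "real N \<le> R" "1 \<le> R" using \<open>0 < N\<close> by auto
  have "1 \<le> B" by (simp add: B_def sum_nonneg)
  interpret bernoulli_graph N y
    by unfold_locales (use x in \<open>auto simp: y_def cube_def PiE_iff\<close>)
  have T_y: "T_fun N G y = T_fun N G x" if "simple_graph G" for G
    by (rule T_fun_cong[OF that]) (simp add: y_def)
  have dev: "expect (\<lambda>S. \<bar>T_fun N G (indic S) - T_fun N G x\<bar>) \<le> 2 * K * R"
    if G: "simple_graph G" "real (card (vset G)) \<le> K" for G
  proof (rule expect_abs_le_square)
    have "expect (\<lambda>S. (T_fun N G (indic S) - T_fun N G x)\<^sup>2) \<le> 3 * real (card (vset G)) ^ 2 * real N ^ 3"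
      using expect_T_fun_square[OF G(1) \<open>0 < N\<close>] by (simp add: T_y[OF G(1)])
    also have "\<dots> \<le> 4 * K\<^sup>2 * R\<^sup>2"
      unfolding \<open>R\<^sup>2 = _\<close> by (intro mult_mono power_mono) (use G(2) in auto)
    finally show "expect (\<lambda>S. (T_fun N G (indic S) - T_fun N G x)\<^sup>2) \<le> (2 * K * R)\<^sup>2"
      by (simp add: power_mult_distrib)
  qed (use K \<open>1 \<le> R\<close> in simp)
  define bern_y where "bern_y = bern (index_pairs N) y"
  have I_y: "(\<Sum>p\<in>index_pairs N. neg_entropy (y p)) = I_fun N x"
    unfolding I_fun_eq by (rule sum.cong) (auto simp: y_def)
  have dev_ln: "expect (\<lambda>S. \<bar>ln (bern_y S) - I_fun N x\<bar>) \<le> 3 * R"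
  proof (rule expect_abs_le_square)
    have "card (index_pairs N) \<le> card ({1..N} \<times> {1..N})"
      by (rule card_mono) (auto simp: index_pairs_def)
    then have "real (card (index_pairs N)) \<le> real (N * N)"
      by (simp only: of_nat_le_iff) simp
    also have "\<dots> \<le> R * R"
      using \<open>real N \<le> R\<close> by (simp add: mult_mono)
    finally show "expect (\<lambda>S. (ln (bern_y S) - I_fun N x)\<^sup>2) \<le> (3 * R)\<^sup>2"
      using expect_ln_bern_square by (simp add: I_y bern_y_def power_mult_distrib power2_eq_square[of R])
  qed (use \<open>1 \<le> R\<close> in simp)
  define X where "X S = \<bar>T_fun N single_edge (indic S) - T_fun N single_edge x\<bar>" for S
  define W where "W S = (\<Sum>r = 1..s. \<bar>\<zeta> r\<bar> * \<bar>T_fun N (H r) (indic S) - T_fun N (H r) x\<bar>)" for S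
  define L where "L S = \<bar>ln (bern_y S) - I_fun N x\<bar>" for S
  have EX: "expect X \<le> 2 * K * R"
    unfolding X_def by (rule dev[OF simple_single_edge]) (use K(2) in \<open>simp add: single_edge_def\<close>)
  have "expect W \<le> (\<Sum>r = 1..s. \<bar>\<zeta> r\<bar> * (2 * K * R))"
    unfolding W_def expect_sum expect_cmult by (intro sum_mono mult_left_mono dev H K(1)) auto
  also have "\<dots> \<le> B * (2 * K * R)"
    unfolding sum_distrib_right[symmetric] by (rule mult_right_mono) (use K(2) \<open>1 \<le> R\<close> in \<open>auto simp: B_def\<close>)
  finally have EW: "expect W \<le> B * (2 * K * R)" .
  have EL: "expect L \<le> 3 * R"
    unfolding L_def by (rule dev_ln)
  define D where "D S = 1 / (8 * K * R) * X S + (1 / (8 * K * R * B) * W S + 1 / (12 * R) * L S)" for S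
  have "expect D = 1 / (8 * K * R) * expect X + (1 / (8 * K * R * B) * expect W + 1 / (12 * R) * expect L)"
    unfolding D_def by (simp only: expect_add expect_cmult)
  also have "\<dots> \<le> 1 / (8 * K * R) * (2 * K * R) + (1 / (8 * K * R * B) * (B * (2 * K * R)) + 1 / (12 * R) * (3 * R))"
    by (intro add_mono mult_left_mono EX EW EL) (use K(2) \<open>1 \<le> R\<close> \<open>1 \<le> B\<close> in auto)
  also have "\<dots> = 3 / 4"
    using K(2) \<open>1 \<le> R\<close> \<open>1 \<le> B\<close> by (simp add: field_simps)
  finally have ED: "expect D \<le> 3 / 4" .
  have XWL: "0 \<le> X S" "0 \<le> W S" "0 \<le> L S" for S
    by (auto simp: X_def W_def L_def intro!: sum_nonneg)
  have parts: "0 \<le> 1 / (8 * K * R) * X S" "0 \<le> 1 / (8 * K * R * B) * W S" "0 \<le> 1 / (12 * R) * L S" for S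
    using XWL[of S] K(2) \<open>1 \<le> R\<close> \<open>1 \<le> B\<close> by auto
  have D_nonneg: "0 \<le> D S" for S
    using parts[of S] unfolding D_def by linarith
  define Good where "Good = {S \<in> support. D S \<le> 1}"
  have "1 - expect D = expect (\<lambda>S. 1 - D S)"
    by (simp add: expect_diff expect_const)
  also have "\<dots> \<le> expect (\<lambda>S. of_bool (S \<in> Good))"
    by (rule expect_mono) (use D_nonneg in \<open>auto simp: Good_def\<close>)
  also have "\<dots> = (\<Sum>S\<in>Good. bern_y S)"
    unfolding expect_def bern_y_def
    by (rule sum.mono_neutral_cong_right) (auto simp: Good_def finite_space)
  finally have mass: "1 / 4 \<le> (\<Sum>S\<in>Good. bern_y S)"
    using ED by linarith
  have good: "X S \<le> 8 * K * R" "W S \<le> 8 * K * R * B" "L S \<le> 12 * R" if "S \<in> Good" for S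
  proof -
    have "D S \<le> 1" using that by (simp add: Good_def)
    then have "1 / (8 * K * R) * X S \<le> 1" "1 / (8 * K * R * B) * W S \<le> 1" "1 / (12 * R) * L S \<le> 1"
      using parts[of S] unfolding D_def by linarith+
    then show "X S \<le> 8 * K * R" "W S \<le> 8 * K * R * B" "L S \<le> 12 * R"
      using K(2) \<open>1 \<le> R\<close> \<open>1 \<le> B\<close> by (simp_all add: pos_divide_le_eq)
  qed
  have "Good \<subseteq> config e N t"
  proof
    fix S assume S: "S \<in> Good"
    then have "S \<subseteq> index_pairs N" by (simp add: Good_def support_def)
    moreover have "\<bar>T_fun N single_edge (indic S) - real N ^ 2 * e\<bar> \<le> real N ^ 2 * t"
      using good(1)[OF S] window unfolding X_def R_def by linarith
    ultimately show "S \<in> config e N t" by (simp add: config_def)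
  qed
  have "Good \<noteq> {}" using mass by auto
  then show "config e N t \<noteq> {}" using \<open>Good \<subseteq> config e N t\<close> by auto
  \<comment> \<open>A lower bound for \<open>F\<close> minus the logarithmic weight, valid at every good edge set.\<close>
  define low where "low = F x - 8 * K * R * B - I_fun N x - 12 * R"
  have point: "bern_y S * exp low \<le> exp (F (indic S))" if S: "S \<in> Good" for S
  proof -
    have pos: "0 < bern_y S" using S by (simp add: Good_def support_def bern_y_def)
    have "\<bar>F (indic S) - F x\<bar> \<le> W S"
      unfolding F_def W_def sum_subtractf[symmetric] right_diff_distrib[symmetric] abs_mult[symmetric]
      by (rule sum_abs)
    then have "ln (bern_y S) + low \<le> F (indic S)"
      using good(2,3)[OF S] unfolding L_def low_def by linarith
    then have "exp (ln (bern_y S) + low) \<le> exp (F (indic S))" by simp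
    then show ?thesis using pos by (simp add: exp_add)
  qed
  have "1 / 4 * exp low \<le> (\<Sum>S\<in>Good. bern_y S) * exp low"
    using mass by (intro mult_right_mono) auto
  also have "\<dots> \<le> (\<Sum>S\<in>Good. exp (F (indic S)))"
    unfolding sum_distrib_right by (rule sum_mono) (rule point)
  also have "\<dots> \<le> (\<Sum>S\<in>config e N t. exp (F (indic S)))"
    by (rule sum_mono2) (use \<open>Good \<subseteq> config e N t\<close> finite_index_pairs in \<open>auto simp: config_def\<close>)
  finally have "ln (1 / 4 * exp low) \<le> ln (\<Sum>S\<in>config e N t. exp (F (indic S)))"
    by (intro ln_mono) auto
  moreover have "ln (1 / 4 * exp low) = low - ln 4"
    by (simp add: ln_mult ln_div)
  moreover have "ln (4 :: real) \<le> 3"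
    using ln_le_minus_one[of "4 :: real"] by simp
  ultimately have final: "low - 3 \<le> ln (\<Sum>S\<in>config e N t. exp (F (indic S)))" by linarith
  have loss: "15 * R \<le> 14 * (K * B * R)"
  proof -
    have "2 * 1 \<le> K * B" using K(2) \<open>1 \<le> B\<close> by (intro mult_mono) auto
    then have "2 * R \<le> K * B * R" using \<open>1 \<le> R\<close> by (intro mult_right_mono) auto
    then show ?thesis using \<open>1 \<le> R\<close> by linarith
  qed
  show "F x - I_fun N x - 22 * K * B * real N powr (3 / 2) \<le> ln (\<Sum>S\<in>config e N t. exp (F (indic S)))"
  proof -
    have "22 * K * B * R = 8 * K * R * B + 14 * (K * B * R)" by simp
    then show ?thesis
      using final loss \<open>1 \<le> R\<close> unfolding low_def R_def[symmetric] by linarith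
  qed
qed

section \<open>Assembling the two bounds\<close>

lemma number_of_pairs: "2 \<le> N \<Longrightarrow> real (N choose 2) = real N * (real N - 1) / 2"
proof -
  assume "2 \<le> N"
  have "even (N * (N - 1))" by auto
  then have "2 * (N choose 2) = N * (N - 1)" by (simp add: choose_two)
  then have "2 * real (N choose 2) = real N * real (N - 1)"
    by (metis of_nat_mult of_nat_numeral)
  then show ?thesis using \<open>2 \<le> N\<close> by (simp add: of_nat_diff)
qed

text \<open>
  As \<open>n\<close> is of order \<open>N\<^sup>2\<close> and \<open>1 / (2 * \<kappa>) < 1 / 4\<close>, the relaxation of the window is at least of the order
  \<open>N powr (3 / 2)\<close> of the random fluctuations of the edge count.
\<close>
lemma window_slack:
  assumes N: "2 \<le> N" and \<kappa>: "8 < \<kappa>"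
  defines "n \<equiv> real (N choose 2)"
  shows "1 / 4 * real N powr (3 / 2) \<le> n powr (- 1 / (2 * \<kappa>)) * n"
proof -
  have n: "real N ^ 2 / 4 \<le> n" "1 \<le> n"
  proof -
    have "2 * 1 \<le> real N * (real N - 1)" using N by (intro mult_mono) auto
    then show "1 \<le> n" using N by (simp add: n_def number_of_pairs)
    have "0 \<le> real N * (real N - 2)" using N by simp
    moreover have "real N ^ 2 / 4 = n - real N * (real N - 2) / 4"
      using N by (simp add: n_def number_of_pairs power2_eq_square field_simps)
    ultimately show "real N ^ 2 / 4 \<le> n" by linarith
  qed
  have "1 / 4 * real N powr (3 / 2) \<le> (1 / 4) powr (3 / 4) * (real N ^ 2) powr (3 / 4)"
  proof (rule mult_mono)
    show "1 / 4 \<le> (1 / 4 :: real) powr (3 / 4)"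
      using powr_mono'[of "3 / 4" 1 "1 / 4 :: real"] by simp
    show "real N powr (3 / 2) \<le> (real N ^ 2) powr (3 / 4)"
      using N by (simp add: powr_powr flip: powr_numeral)
  qed auto
  also have "\<dots> = (real N ^ 2 / 4) powr (3 / 4)"
    by (simp add: powr_mult[symmetric])
  also have "\<dots> \<le> n powr (3 / 4)"
    using n by (intro powr_mono2) auto
  also have "\<dots> \<le> n powr (- 1 / (2 * \<kappa>) + 1)"
    using n \<kappa> by (intro powr_mono) (auto simp: field_simps)
  also have "\<dots> = n powr (- 1 / (2 * \<kappa>)) * n"
    using n by (subst powr_add) simp
  finally show ?thesis .
qed

lemma error_term_ge:
  assumes N: "2 \<le> N" and \<kappa>: "8 < \<kappa>" and B: "1 \<le> B"
  shows "B * real N powr (- 1 / 4)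
    \<le> 2 * (B powr (8 / 5) * real N powr ((8 - \<kappa>) / (5 * \<kappa>)) * ln (real N) powr (1 / 5) * (1 + ln B / ln (real N)))"
proof -
  have "ln 2 \<le> ln (real N)" using N by simp
  then have lnN: "1 / 2 \<le> ln (real N)"
    using ln_le_minus_one[of "1 / 2 :: real"] by (simp add: ln_div)
  have "1 / 2 \<le> (1 / 2 :: real) powr (1 / 5)"
    using powr_mono'[of "1 / 5" 1 "1 / 2 :: real"] by simp
  also have "\<dots> \<le> ln (real N) powr (1 / 5)"
    using lnN by (intro powr_mono2) auto
  finally have log: "1 / 2 \<le> ln (real N) powr (1 / 5)" .
  have "B powr 1 \<le> B powr (8 / 5)" using B by (intro powr_mono) auto
  then have "B \<le> B powr (8 / 5)" using B by simp
  moreover have "real N powr (- 1 / 4) \<le> real N powr ((8 - \<kappa>) / (5 * \<kappa>))"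
    using N \<kappa> by (intro powr_mono) (auto simp: field_simps)
  ultimately have "B * real N powr (- 1 / 4) \<le> B powr (8 / 5) * real N powr ((8 - \<kappa>) / (5 * \<kappa>))"
    by (intro mult_mono) auto
  from mult_mono[OF this log] have "B * real N powr (- 1 / 4) * (1 / 2)
      \<le> B powr (8 / 5) * real N powr ((8 - \<kappa>) / (5 * \<kappa>)) * ln (real N) powr (1 / 5)"
    by simp
  moreover have "1 \<le> 1 + ln B / ln (real N)"
    using B lnN by simp
  ultimately have "B * real N powr (- 1 / 4) * (1 / 2) * 1
      \<le> B powr (8 / 5) * real N powr ((8 - \<kappa>) / (5 * \<kappa>)) * ln (real N) powr (1 / 5) * (1 + ln B / ln (real N))"
    by (rule mult_mono) (use B in auto)
  then show ?thesis by (simp add: mult.commute[of 2])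
qed

text \<open>
  The choice \<open>w \<approx> sqrt N\<close> of the bound on the number of stars: the bits revealed contribute \<open>w / N\<close>, of order
  \<open>N powr (- 1 / 2)\<close>, and the factorization error \<open>1 / sqrt w\<close>, of order \<open>N powr (- 1 / 4)\<close>.
\<close>
lemma pinning_cost_le:
  fixes B a M :: real
  assumes N: "2 \<le> N" and B: "1 \<le> B" and "0 \<le> a" "0 \<le> M"
  defines "w \<equiv> nat \<lceil>sqrt (real N)\<rceil>"
  shows "(real w * real N * ln 2 + B * (a * sqrt (M / real w) * real N ^ 2)) / real N ^ 2
    \<le> (2 + a * sqrt M) * (B * real N powr (- 1 / 4))"
proof -
  \<comment> \<open>In terms of \<open>d\<close> all powers of \<open>N\<close> that occur are natural powers.\<close>
  define d where "d = real N powr (1 / 4)"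
  have N4: "real N = d ^ 4" and sq: "sqrt (real N) = d ^ 2" and inv: "real N powr (- 1 / 4) = 1 / d"
    using N by (simp_all add: d_def powr_powr powr_half_sqrt[symmetric] powr_minus_divide[symmetric] flip: powr_numeral)
  have "real N powr 0 \<le> d" unfolding d_def using N by (intro powr_mono) auto
  then have d: "1 \<le> d" using N by simp
  have w: "d ^ 2 \<le> real w" "real w \<le> 2 * d ^ 2"
  proof -
    have "1 \<le> d ^ 2" using d by simp
    then show "d ^ 2 \<le> real w" "real w \<le> 2 * d ^ 2"
      unfolding w_def sq by linarith+
  qed
  have "real w * ln 2 \<le> 2 * d ^ 2 * 1"
    using w ln_le_minus_one[of "2 :: real"] by (intro mult_mono) auto
  also have "\<dots> \<le> 2 * (B * d ^ 3)"
  proof -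
    have "1 * d ^ 2 \<le> B * d ^ 3"
      using B d by (intro mult_mono power_increasing) auto
    then show ?thesis by simp
  qed
  finally have 1: "real w * ln 2 \<le> 2 * (B * d ^ 3)" .
  have "0 < d ^ 2" using d by simp
  then have "M / real w \<le> M / d ^ 2"
    using w(1) \<open>0 \<le> M\<close> by (intro divide_left_mono mult_pos_pos) linarith+
  then have "sqrt (M / real w) \<le> sqrt (M / d ^ 2)"
    by (rule real_sqrt_le_mono)
  also have "\<dots> = sqrt M / d"
    using d by (simp add: real_sqrt_divide)
  finally have 2: "sqrt (M / real w) \<le> sqrt M / d" .
  have "(real w * real N * ln 2 + B * (a * sqrt (M / real w) * real N ^ 2)) / real N ^ 2
      = real w * ln 2 / d ^ 4 + B * (a * sqrt (M / real w))"
    unfolding N4 using d by (simp add: field_simps power2_eq_square)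
  also have "\<dots> \<le> 2 * (B * d ^ 3) / d ^ 4 + B * (a * (sqrt M / d))"
    using 1 2 B \<open>0 \<le> a\<close> d by (intro add_mono divide_right_mono mult_left_mono) auto
  also have "\<dots> = (2 + a * sqrt M) * (B * (1 / d))"
    using d by (simp add: field_simps power4_eq_xxxx power3_eq_cube)
  finally show ?thesis by (simp only: inv)
qed

theorem theorem4p1:
  fixes s :: nat and H :: "nat \<Rightarrow> nat sgraph" and k :: "nat \<Rightarrow> nat" and e :: real
  assumes "s \<ge> 1"
    and "\<And>r. r \<in> {1..s} \<Longrightarrow> simple_graph (H r) \<and> vset (H r) = {1..k r}"
    and "H 1 = single_edge"
    and "e \<in> {0..1}"
  shows "\<exists>c>0. \<exists>C>0. \<forall>(N::nat)\<ge>2. \<forall>t>0. \<forall>\<kappa>>8. \<forall>\<zeta> :: nat \<Rightarrow> real.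
    (let n = real (N choose 2);
         f = (\<lambda>x. \<Sum>r = 1..s. \<zeta> r * T_fun N (H r) x);
         h = (\<lambda>x. T_fun N (H 1) x - real N ^ 2 * e);
         B = 1 + (\<Sum>r = 1..s. \<bar>\<zeta> r\<bar>);
         t' = 2 * real N * t / (real N - 1)
     in
       (SUP x \<in> {x \<in> cube N. \<bar>h x\<bar> \<le> (t' - c * n powr (- 1 / (2 * \<kappa>))) * n}.
            ereal ((f x - I_fun N x) / real N ^ 2))
          - ereal (C * B * real N powr (- 1 / 2))
         \<le> cond_psi s H e \<zeta> N t
     \<and> cond_psi s H e \<zeta> N t
         \<le> (SUP x \<in> {x \<in> cube N. \<bar>h x\<bar> \<le> (t' + c * n powr (- 1 / (2 * \<kappa>))) * n}.
               ereal ((f x - I_fun N x) / real N ^ 2))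
           + ereal (C * B powr (8 / 5) * real N powr ((8 - \<kappa>) / (5 * \<kappa>))
                      * ln (real N) powr (1 / 5) * (1 + ln B / ln (real N))
                    + C * B ^ 2 * real N powr ((2 - \<kappa>) / (2 * \<kappa>))))"
proof -
  define K where "K = 2 + (\<Sum>r = 1..s. real (card (vset (H r))))"
  define a where "a = (\<Sum>r = 1..s. real (card (edge_pairs (H r))))"
  define M where "M = (\<Sum>r = 1..s. 2 ^ card (edge_pairs (H r)) :: real)"
  \<comment> \<open>The first summand serves the lower bound, the second the upper bound.\<close>
  define C where "C = 22 * K + 2 * (2 + a * sqrt M)"
  have simple: "simple_graph (H r)" if "r \<in> {1..s}" for r
    using assms(2) that by blast
  have K: "2 \<le> K" "real (card (vset (H r))) \<le> K" if "r \<in> {1..s}" for r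
    unfolding K_def using member_le_sum[of r "{1..s}" "\<lambda>r. real (card (vset (H r)))"] that
    by (auto intro: sum_nonneg)
  have "2 \<le> K" by (simp add: K_def sum_nonneg)
  have a: "real (card (edge_pairs (H r))) \<le> a" if "r \<in> {1..s}" for r
    unfolding a_def using member_le_sum[of r "{1..s}" "\<lambda>r. real (card (edge_pairs (H r)))"] that by auto
  have "0 \<le> a" "0 \<le> M" by (simp_all add: a_def M_def sum_nonneg)
  then have "0 \<le> 2 * (2 + a * sqrt M)" by simp
  then have C: "22 * K \<le> C" "2 * (2 + a * sqrt M) \<le> C" "0 < C"
    using \<open>2 \<le> K\<close> unfolding C_def by linarith+
  show ?thesis
  \<comment> \<open>The window slack is at least \<open>c / 4\<close> times \<open>N powr (3 / 2)\<close>, and \<open>8 * K\<close> such units are needed.\<close>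
  proof (rule exI[of _ "32 * K"], rule conjI, use \<open>2 \<le> K\<close> in simp, rule exI[of _ C], rule conjI, rule C(3),
      intro allI impI)
    fix N :: nat and t \<kappa> :: real and \<zeta> :: "nat \<Rightarrow> real"
    assume N: "2 \<le> N" and "0 < t" and \<kappa>: "8 < \<kappa>"
    define n where "n = real (N choose 2)"
    define F where "F = (\<lambda>x. \<Sum>r = 1..s. \<zeta> r * T_fun N (H r) x)"
    define B where "B = 1 + (\<Sum>r = 1..s. \<bar>\<zeta> r\<bar>)"
    define t' where "t' = 2 * real N * t / (real N - 1)"
    define slack where "slack = 32 * K * n powr (- 1 / (2 * \<kappa>)) * n"
    define h where "h = (\<lambda>x. T_fun N (H 1) x - real N ^ 2 * e)"
    have h: "h x = T_fun N single_edge x - real N ^ 2 * e" for x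
      by (simp only: h_def assms(3))
    define val where "val x = ereal ((F x - I_fun N x) / real N ^ 2)" for x
    define err where "err = C * B powr (8 / 5) * real N powr ((8 - \<kappa>) / (5 * \<kappa>))
                      * ln (real N) powr (1 / 5) * (1 + ln B / ln (real N))
                    + C * B ^ 2 * real N powr ((2 - \<kappa>) / (2 * \<kappa>))"
    define Part where "Part = (\<Sum>S\<in>config e N t. exp (F (indic S)))"
    have "1 \<le> B" by (simp add: B_def sum_nonneg)
    have "0 < N" using N by simp
    have t'n: "t' * n = real N ^ 2 * t"
      using N by (simp add: t'_def n_def number_of_pairs power2_eq_square)
    have windows: "(t' - 32 * K * n powr (- 1 / (2 * \<kappa>))) * n = real N ^ 2 * t - slack"
      "(t' + 32 * K * n powr (- 1 / (2 * \<kappa>))) * n = real N ^ 2 * t + slack"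
      by (simp_all add: slack_def left_diff_distrib distrib_right t'n)
    have "32 * K * (1 / 4 * real N powr (3 / 2)) \<le> 32 * K * (n powr (- 1 / (2 * \<kappa>)) * n)"
      unfolding n_def by (rule mult_left_mono[OF window_slack[OF N \<kappa>]]) (use \<open>2 \<le> K\<close> in simp)
    then have slack: "8 * K * real N powr (3 / 2) \<le> slack" by (simp add: slack_def)
    have psi: "cond_psi s H e \<zeta> N t = (if config e N t = {} then - \<infinity> else ereal (ln Part / real N ^ 2))"
      using cond_psi_eq[OF simple \<open>0 < N\<close>] by (simp add: Part_def F_def)

    have "(SUP x\<in>{x \<in> cube N. \<bar>h x\<bar> \<le> real N ^ 2 * t - slack}. val x)
        \<le> cond_psi s H e \<zeta> N t + ereal (C * B * real N powr (- 1 / 2))"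
    proof (rule SUP_least)
      fix x assume x: "x \<in> {x \<in> cube N. \<bar>h x\<bar> \<le> real N ^ 2 * t - slack}"
      then have "\<bar>T_fun N single_edge x - real N ^ 2 * e\<bar> \<le> real N ^ 2 * t - 8 * K * real N powr (3 / 2)"
        using slack by (simp add: h)
      from ln_partition_ge[OF simple \<open>0 < N\<close> _ K(2) \<open>2 \<le> K\<close> this] x
      have ne: "config e N t \<noteq> {}" and "F x - I_fun N x - 22 * K * B * real N powr (3 / 2) \<le> ln Part"
        by (simp_all add: F_def B_def Part_def)
      moreover have "22 * K * B * real N powr (3 / 2) \<le> C * B * real N powr (3 / 2)"
        using C(1) \<open>1 \<le> B\<close> by (intro mult_right_mono) auto
      ultimately have "F x - I_fun N x \<le> ln Part + C * B * real N powr (3 / 2)" by linarith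
      then have "(F x - I_fun N x) / real N ^ 2 \<le> (ln Part + C * B * real N powr (3 / 2)) / real N ^ 2"
        by (rule divide_right_mono) simp
      also have "\<dots> = ln Part / real N ^ 2 + C * B * (real N powr (3 / 2) / real N ^ 2)"
        by (simp add: add_divide_distrib)
      also have "real N powr (3 / 2) / real N ^ 2 = real N powr (- 1 / 2)"
        using powr_diff[of "real N" "3 / 2" 2] \<open>0 < N\<close> by simp
      finally show "val x \<le> cond_psi s H e \<zeta> N t + ereal (C * B * real N powr (- 1 / 2))"
        using ne by (simp add: psi val_def)
    qed
    then have lower: "(SUP x\<in>{x \<in> cube N. \<bar>h x\<bar> \<le> real N ^ 2 * t - slack}. val x)
        - ereal (C * B * real N powr (- 1 / 2)) \<le> cond_psi s H e \<zeta> N t"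
      by (simp add: ereal_minus_le)

    have upper: "cond_psi s H e \<zeta> N t \<le> (SUP x\<in>{x \<in> cube N. \<bar>h x\<bar> \<le> real N ^ 2 * t + slack}. val x) + ereal err"
    proof (cases "config e N t = {}")
      case True
      then show ?thesis by (simp add: psi)
    next
      case False
      define w where "w = nat \<lceil>sqrt (real N)\<rceil>"
      have "0 < w" using \<open>0 < N\<close> by (simp add: w_def)
      have edge_sets: "config e N t \<subseteq> Pow (index_pairs N)" by (auto simp: config_def)
      have in_window: "\<bar>T_fun N single_edge (indic S) - real N ^ 2 * e\<bar> \<le> real N ^ 2 * t" if "S \<in> config e N t" for S
        using that by (simp add: config_def)
      obtain x where x: "x \<in> cube N" "\<bar>T_fun N single_edge x - real N ^ 2 * e\<bar> \<le> real N ^ 2 * t"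
        "ln Part \<le> F x - I_fun N x + real w * real N * ln 2
          + (\<Sum>r = 1..s. \<bar>\<zeta> r\<bar>) * (a * sqrt (M / real w) * real N ^ 2)"
        unfolding Part_def F_def M_def
        by (rule ln_partition_le[OF simple assms(1) \<open>0 < N\<close> \<open>0 < w\<close> edge_sets False a in_window])
      have "(\<Sum>r = 1..s. \<bar>\<zeta> r\<bar>) * (a * sqrt (M / real w) * real N ^ 2) \<le> B * (a * sqrt (M / real w) * real N ^ 2)"
        using \<open>0 \<le> a\<close> \<open>0 \<le> M\<close> by (intro mult_right_mono) (auto simp: B_def)
      with x(3) have "ln Part \<le> (F x - I_fun N x) + (real w * real N * ln 2 + B * (a * sqrt (M / real w) * real N ^ 2))"
        by linarith
      then have "ln Part / real N ^ 2
          \<le> ((F x - I_fun N x) + (real w * real N * ln 2 + B * (a * sqrt (M / real w) * real N ^ 2))) / real N ^ 2"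
        by (rule divide_right_mono) simp
      also have "\<dots> = (F x - I_fun N x) / real N ^ 2
          + (real w * real N * ln 2 + B * (a * sqrt (M / real w) * real N ^ 2)) / real N ^ 2"
        by (rule add_divide_distrib)
      also have "\<dots> \<le> (F x - I_fun N x) / real N ^ 2 + err"
      proof (rule add_left_mono)
        let ?E = "B powr (8 / 5) * real N powr ((8 - \<kappa>) / (5 * \<kappa>)) * ln (real N) powr (1 / 5) * (1 + ln B / ln (real N))"
        have "0 \<le> ?E"
          using \<open>1 \<le> B\<close> N by simp
        have "(real w * real N * ln 2 + B * (a * sqrt (M / real w) * real N ^ 2)) / real N ^ 2
            \<le> (2 + a * sqrt M) * (B * real N powr (- 1 / 4))"
          unfolding w_def by (rule pinning_cost_le[OF N \<open>1 \<le> B\<close> \<open>0 \<le> a\<close> \<open>0 \<le> M\<close>])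
        also have "\<dots> \<le> (2 + a * sqrt M) * (2 * ?E)"
          using \<open>0 \<le> a\<close> \<open>0 \<le> M\<close> by (intro mult_left_mono error_term_ge[OF N \<kappa> \<open>1 \<le> B\<close>]) auto
        also have "\<dots> = 2 * (2 + a * sqrt M) * ?E" by (simp only: mult.assoc mult.left_commute)
        also have "\<dots> \<le> C * ?E"
          by (rule mult_right_mono[OF C(2) \<open>0 \<le> ?E\<close>])
        also have "\<dots> \<le> err"
          using C(3) by (simp add: err_def mult.assoc)
        finally show "(real w * real N * ln 2 + B * (a * sqrt (M / real w) * real N ^ 2)) / real N ^ 2 \<le> err" .
      qed
      finally have "cond_psi s H e \<zeta> N t \<le> val x + ereal err"
        using False by (simp add: psi val_def)
      also have "\<dots> \<le> (SUP x\<in>{x \<in> cube N. \<bar>h x\<bar> \<le> real N ^ 2 * t + slack}. val x) + ereal err"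
      proof (intro add_right_mono SUP_upper)
        have "0 \<le> 8 * K * real N powr (3 / 2)" using \<open>2 \<le> K\<close> by simp
        then show "x \<in> {x \<in> cube N. \<bar>h x\<bar> \<le> real N ^ 2 * t + slack}"
          using x(1,2) slack by (simp add: h)
      qed
      finally show ?thesis .
    qed

    show "let n = real (N choose 2);
         f = (\<lambda>x. \<Sum>r = 1..s. \<zeta> r * T_fun N (H r) x);
         h = (\<lambda>x. T_fun N (H 1) x - real N ^ 2 * e);
         B = 1 + (\<Sum>r = 1..s. \<bar>\<zeta> r\<bar>);
         t' = 2 * real N * t / (real N - 1)
     in
       (SUP x \<in> {x \<in> cube N. \<bar>h x\<bar> \<le> (t' - 32 * K * n powr (- 1 / (2 * \<kappa>))) * n}.
            ereal ((f x - I_fun N x) / real N ^ 2))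
          - ereal (C * B * real N powr (- 1 / 2))
         \<le> cond_psi s H e \<zeta> N t
     \<and> cond_psi s H e \<zeta> N t
         \<le> (SUP x \<in> {x \<in> cube N. \<bar>h x\<bar> \<le> (t' + 32 * K * n powr (- 1 / (2 * \<kappa>))) * n}.
               ereal ((f x - I_fun N x) / real N ^ 2))
           + ereal (C * B powr (8 / 5) * real N powr ((8 - \<kappa>) / (5 * \<kappa>))
                      * ln (real N) powr (1 / 5) * (1 + ln B / ln (real N))
                    + C * B ^ 2 * real N powr ((2 - \<kappa>) / (2 * \<kappa>)))"
      unfolding Let_def n_def[symmetric] F_def[symmetric] B_def[symmetric] t'_def[symmetric] windows
        h_def[symmetric]
      using lower upper by (simp only: val_def err_def F_def h_def simp_thms)
  qed
qed

end
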